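(* Let $\mathsf{C}_\alpha$ be a circular cylinder of radius $\rho$ in $\mathbb{E}(\kappa,\tau)$. Let $L_0$ be given by $$L_0=\begin{cases}\dfrac{2\pi}{-\kappa}\sinh(\rho\sqrt{-\kappa})\sqrt{-\kappa+4\tau^2\tanh^2\!\left(\frac{\rho\sqrt{-\kappa}}{2}\right)} & \text{if }\kappa<0,\\[2mm] 2\pi\rho\sqrt{1+\tau^2\rho^2} & \text{if }\kappa=0,\\[2mm] \dfrac{2\pi}{\kappa}\sin(\rho\sqrt{\kappa})\sqrt{\kappa+4\tau^2\tan^2\!\left(\frac{\rho\sqrt{\kappa}}{2}\right)} & \text{if }\kappa>0.\end{cases}$$ If $L>L_0$, then the truncated cylinder $\mathsf{C}_\alpha(L)=\{(x,y,z)\in\mathsf{C}_\alpha: 0\le z\le L\}$ is not stable. If $\kappa>0$ and $\tau\neq 0$, it is assumed in addition that $L<8\tau\pi/\kappa$.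
   Context: **The space $\mathbb{E}(\kappa,\tau)$.** Here $\kappa,\tau\in\mathbb{R}$. Let $\mathcal{R}(\kappa,\tau)=\mathbb{R}^3$ if $\kappa\ge 0$, and $\mathcal{R}(\kappa,\tau)=\{(x,y):x^2+y^2<4/(-\kappa)\}\times\mathbb{R}$ if $\kappa<0$, with coordinates $(x,y,z)$ and Riemannian metric $$g=\sigma^2(dx^2+dy^2)+\big(\sigma\tau(y\,dx-x\,dy)+dz\big)^2,\qquad \sigma=\frac{4}{4+\kappa(x^2+y^2)}.$$ This is the model used for $\mathbb{E}(\kappa,\tau)$ (global if $\kappa\le 0$; if $\kappa>0$ it omits one fiber, and if $\kappa>0,\tau>0$ the points $(x,y,z)$ and $(x,y,z+8\tau\pi/\kappa)$ correspond to the same point of the Berger sphere, which is the reason for the bound $L<8\tau\pi/\kappa$). The map $\pi(x,y,z)=(x,y)$ is a Riemannian submersion onto $\mathbb{M}^2(\kappa)$, the two-dimensional space form of curvature $\kappa$, with metric $\sigma^2(dx^2+dy^2)$. **Circular cylinders.** A circle of $\mathbb{M}^2(\kappa)$ is a closed curve $\alpha$ of constant geodesic curvature $\kappa_g$ (where $\kappa_g$ is any positive constant if $\kappa\ge0$, and $\kappa_g^2>-\kappa$ if $\kappa<0$). The circular cylinder over the circle $\alpha$ is $\mathsf{C}_\alpha=\pi^{-1}(\alpha)$; its radius $\rho$ is the (geodesic) radius of $\alpha$ in $\mathbb{M}^2(\kappa)$. It has constant mean curvature $\kappa_g/2$. **Stability.** For a compact oriented constant mean curvature surface $\Sigma\subset\mathbb{E}(\kappa,\tau)$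 with boundary and unit normal $N$, let $\mathcal{L}=\Delta+|A|^2+\mathrm{Ric}(N)$ be the Jacobi operator, where $\Delta$ is the Laplacian of $\Sigma$, $A$ its second fundamental form, and $\mathrm{Ric}(N)$ the Ricci curvature of the ambient space in the direction $N$. Let $Q[u]=-\int_\Sigma u\,\mathcal{L}[u]$. The surface $\Sigma$ is stable if $Q[u]\ge 0$ for every smooth function $u$ on $\Sigma$ with $u=0$ on $\partial\Sigma$ and $\int_\Sigma u=0$ (equivalently, the second variation of area is nonnegative for all volume preserving variations fixing the boundary).
   Formalization: The circle α is taken centred at the origin of M²(κ). For τ≠0 the claim can fail for off-centre circles, since the slab 0≤z≤L is not invariant under isometries moving the axis (κ=0, distant centre: stable). For τ=0 the off-centre case follows by an isometry preserving z. *)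

theory Defs
  imports "HOL-Analysis.Analysis"
begin

section \<open>Riemannian geometry in a coordinate domain\<close>

text \<open>A metric on a domain of \<open>real^'n\<close> is a field of bilinear forms: \<open>g p v w\<close> is the inner
  product at \<open>p\<close> of the coordinate vectors \<open>v\<close> and \<open>w\<close>.\<close>

type_synonym 'n metric_field = "real^'n \<Rightarrow> real^'n \<Rightarrow> real^'n \<Rightarrow> real"

text \<open>For open \<open>S\<close>, \<open>Ck_on k S f\<close> says that \<open>f\<close> is \<open>k\<close> times continuously differentiable.\<close>

primrec Ck_on :: "nat \<Rightarrow> 'a::euclidean_space set \<Rightarrow> ('a \<Rightarrow> 'b::real_normed_vector) \<Rightarrow> bool" where
  "Ck_on 0 S f \<longleftrightarrow> continuous_on S f"
| "Ck_on (Suc k) S f \<longleftrightarrow> f differentiable_on S \<and>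
     (\<forall>b\<in>Basis. Ck_on k S (\<lambda>x. frechet_derivative f (at x) b))"

definition smooth_on :: "'a::euclidean_space set \<Rightarrow> ('a \<Rightarrow> 'b::real_normed_vector) \<Rightarrow> bool" where
  "smooth_on S f \<longleftrightarrow> (\<forall>k. Ck_on k S f)"

definition partial :: "'n \<Rightarrow> (real^'n \<Rightarrow> 'b::real_normed_vector) \<Rightarrow> real^'n \<Rightarrow> 'b" where
  "partial i f p = frechet_derivative f (at p) (axis i 1)"

definition gram :: "'n::finite metric_field \<Rightarrow> real^'n \<Rightarrow> real^'n^'n" where
  "gram g p = (\<chi> i j. g p (axis i 1) (axis j 1))"

abbreviation gram_inv :: "'n::finite metric_field \<Rightarrow> real^'n \<Rightarrow> real^'n^'n" where
  "gram_inv g p \<equiv> matrix_inv (gram g p)"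

definition christoffel :: "'n::finite metric_field \<Rightarrow> 'n \<Rightarrow> 'n \<Rightarrow> 'n \<Rightarrow> real^'n \<Rightarrow> real" where
  "christoffel g k i j p = (1/2) * (\<Sum>l\<in>UNIV. gram_inv g p $ k $ l *
     (partial i (\<lambda>q. gram g q $ j $ l) p + partial j (\<lambda>q. gram g q $ i $ l) p
      - partial l (\<lambda>q. gram g q $ i $ j) p))"

definition connection_term :: "'n::finite metric_field \<Rightarrow> real^'n \<Rightarrow> real^'n \<Rightarrow> real^'n \<Rightarrow> real^'n" where
  "connection_term g p v w =
     (\<chi> k. \<Sum>i\<in>UNIV. \<Sum>j\<in>UNIV. christoffel g k i j p * v $ i * w $ j)"

text \<open>\<open>riemann g l i j k\<close> is the \<open>l\<close>-th coordinate of \<open>R(\<partial>\<^sub>i, \<partial>\<^sub>j) \<partial>\<^sub>k\<close>, where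
  \<open>R(X, Y) = [\<nabla>\<^sub>X, \<nabla>\<^sub>Y] - \<nabla>\<^bsub>[X, Y]\<^esub>\<close>; round spheres have positive Ricci curvature.\<close>

definition riemann :: "'n::finite metric_field \<Rightarrow> 'n \<Rightarrow> 'n \<Rightarrow> 'n \<Rightarrow> 'n \<Rightarrow> real^'n \<Rightarrow> real" where
  "riemann g l i j k p =
     partial i (christoffel g l j k) p - partial j (christoffel g l i k) p
     + (\<Sum>m\<in>UNIV. christoffel g m j k p * christoffel g l i m p
                 - christoffel g m i k p * christoffel g l j m p)"

definition ricci :: "'n::finite metric_field \<Rightarrow> real^'n \<Rightarrow> real^'n \<Rightarrow> real^'n \<Rightarrow> real" where
  "ricci g p v w = (\<Sum>j\<in>UNIV. \<Sum>k\<in>UNIV. (\<Sum>i\<in>UNIV. riemann g i i j k p) * v $ j * w $ k)"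

definition volume_density :: "'n::finite metric_field \<Rightarrow> real^'n \<Rightarrow> real" where
  "volume_density g p = sqrt (det (gram g p))"

definition laplace_beltrami :: "'n::finite metric_field \<Rightarrow> (real^'n \<Rightarrow> real) \<Rightarrow> real^'n \<Rightarrow> real" where
  "laplace_beltrami g f p = (1 / volume_density g p) *
     (\<Sum>i\<in>UNIV. partial i
        (\<lambda>q. volume_density g q * (\<Sum>j\<in>UNIV. gram_inv g q $ i $ j * partial j f q)) p)"

definition curve_length :: "'n::finite metric_field \<Rightarrow> (real \<Rightarrow> real^'n) \<Rightarrow> real" where
  "curve_length g \<gamma> = integral {0..1}
     (\<lambda>t. sqrt (g (\<gamma> t) (vector_derivative \<gamma> (at t)) (vector_derivative \<gamma> (at t))))"

text \<open>The curves are \<open>C\<^sup>1\<close> up to the endpoints, so that their lengths are finite: the library's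
  piecewise \<open>C\<^sup>1\<close> curves may have an unbounded derivative at a break point, and then the integral
  could have the default value \<open>0\<close>. The infimum is the same as over piecewise \<open>C\<^sup>1\<close> curves with
  bounded derivative.\<close>

definition geodesic_dist :: "'n::finite metric_field \<Rightarrow> (real^'n) set \<Rightarrow> real^'n \<Rightarrow> real^'n \<Rightarrow> real" where
  "geodesic_dist g S p q = Inf {curve_length g \<gamma> | \<gamma>.
     \<gamma> C1_differentiable_on {0..1} \<and> \<gamma> ` {0..1} \<subseteq> S \<and> \<gamma> 0 = p \<and> \<gamma> 1 = q}"

definition cov_accel :: "'n::finite metric_field \<Rightarrow> (real \<Rightarrow> real^'n) \<Rightarrow> real \<Rightarrow> real^'n" where
  "cov_accel g \<gamma> t = vector_derivative (\<lambda>s. vector_derivative \<gamma> (at s)) (at t)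
     + connection_term g (\<gamma> t) (vector_derivative \<gamma> (at t)) (vector_derivative \<gamma> (at t))"

section \<open>Parametrized surfaces and the Jacobi operator\<close>

text \<open>\<open>X\<close> is a parametrization of a surface in a three-dimensional domain with metric \<open>g\<close>.
  Functions on the surface are represented in the parameters \<open>q\<close>.\<close>

definition first_form :: "3 metric_field \<Rightarrow> (real^2 \<Rightarrow> real^3) \<Rightarrow> 2 metric_field" where
  "first_form g X q v w =
     g (X q) (frechet_derivative X (at q) v) (frechet_derivative X (at q) w)"

text \<open>The Euclidean cross product of the coordinate tangent vectors is a covector that annihilates
  the tangent plane; raising its index with \<open>g\<close> gives a \<open>g\<close>-normal vector.\<close>

definition unit_normal :: "3 metric_field \<Rightarrow> (real^2 \<Rightarrow> real^3) \<Rightarrow> real^2 \<Rightarrow> real^3" where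
  "unit_normal g X q =
     (let n = gram_inv g (X q) *v cross3 (partial 1 X q) (partial 2 X q)
      in n /\<^sub>R sqrt (g (X q) n n))"

definition second_form :: "3 metric_field \<Rightarrow> (real^2 \<Rightarrow> real^3) \<Rightarrow> real^2 \<Rightarrow> 2 \<Rightarrow> 2 \<Rightarrow> real" where
  "second_form g X q i j =
     g (X q) (partial i (partial j X) q + connection_term g (X q) (partial i X q) (partial j X q))
       (unit_normal g X q)"

definition norm_sq_second_form :: "3 metric_field \<Rightarrow> (real^2 \<Rightarrow> real^3) \<Rightarrow> real^2 \<Rightarrow> real" where
  "norm_sq_second_form g X q =
     (\<Sum>i\<in>UNIV. \<Sum>j\<in>UNIV. \<Sum>k\<in>UNIV. \<Sum>l\<in>UNIV.
        gram_inv (first_form g X) q $ i $ k * gram_inv (first_form g X) q $ j $ l *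
        second_form g X q i j * second_form g X q k l)"

definition jacobi_operator ::
    "3 metric_field \<Rightarrow> (real^2 \<Rightarrow> real^3) \<Rightarrow> (real^2 \<Rightarrow> real) \<Rightarrow> real^2 \<Rightarrow> real" where
  "jacobi_operator g X f q = laplace_beltrami (first_form g X) f q
     + (norm_sq_second_form g X q + ricci g (X q) (unit_normal g X q) (unit_normal g X q)) * f q"

definition surface_integral ::
    "3 metric_field \<Rightarrow> (real^2 \<Rightarrow> real^3) \<Rightarrow> (real^2) set \<Rightarrow> (real^2 \<Rightarrow> real) \<Rightarrow> real" where
  "surface_integral g X D f = integral D (\<lambda>q. f q * volume_density (first_form g X) q)"

definition index_form ::
    "3 metric_field \<Rightarrow> (real^2 \<Rightarrow> real^3) \<Rightarrow> (real^2) set \<Rightarrow> (real^2 \<Rightarrow> real) \<Rightarrow> real" where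
  "index_form g X D f = - surface_integral g X D (\<lambda>q. f q * jacobi_operator g X f q)"

text \<open>Stability of the compact surface \<open>X ` D\<close> with boundary \<open>B\<close>, where the immersion \<open>X\<close> is defined
  near \<open>D\<close> and covers the surface once up to a null set. As the surfaces considered
  are compact and embedded, their smooth functions are the restrictions of the smooth functions
  on \<open>real^3\<close>.\<close>

definition stable_surface ::
    "3 metric_field \<Rightarrow> (real^2 \<Rightarrow> real^3) \<Rightarrow> (real^2) set \<Rightarrow> (real^3) set \<Rightarrow> bool" where
  "stable_surface g X D B \<longleftrightarrow>
     (\<forall>u :: real^3 \<Rightarrow> real. smooth_on UNIV u \<longrightarrow> (\<forall>p\<in>B. u p = 0) \<longrightarrow>
        surface_integral g X D (u \<circ> X) = 0 \<longrightarrow> index_form g X D (u \<circ> X) \<ge> 0)"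

section \<open>The spaces \<open>\<bbbM>\<^sup>2(\<kappa>)\<close> and \<open>\<bbbE>(\<kappa>, \<tau>)\<close>\<close>

definition M2_domain :: "real \<Rightarrow> (real^2) set" where
  "M2_domain \<kappa> = {p. \<kappa> < 0 \<longrightarrow> (p$1)\<^sup>2 + (p$2)\<^sup>2 < 4 / (- \<kappa>)}"

definition conf_factor :: "real \<Rightarrow> real^2 \<Rightarrow> real" where
  "conf_factor \<kappa> p = 4 / (4 + \<kappa> * ((p$1)\<^sup>2 + (p$2)\<^sup>2))"

definition M2_metric :: "real \<Rightarrow> 2 metric_field" where
  "M2_metric \<kappa> p v w = (conf_factor \<kappa> p)\<^sup>2 * (v$1 * w$1 + v$2 * w$2)"

definition fiber_proj :: "real^3 \<Rightarrow> real^2" where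
  "fiber_proj p = vector [p$1, p$2]"

definition E_domain :: "real \<Rightarrow> (real^3) set" where
  "E_domain \<kappa> = {p. fiber_proj p \<in> M2_domain \<kappa>}"

definition connection_form :: "real \<Rightarrow> real \<Rightarrow> real^3 \<Rightarrow> real^3 \<Rightarrow> real" where
  "connection_form \<kappa> \<tau> p v =
     conf_factor \<kappa> (fiber_proj p) * \<tau> * (p$2 * v$1 - p$1 * v$2) + v$3"

definition E_metric :: "real \<Rightarrow> real \<Rightarrow> 3 metric_field" where
  "E_metric \<kappa> \<tau> p v w = M2_metric \<kappa> (fiber_proj p) (fiber_proj v) (fiber_proj w)
     + connection_form \<kappa> \<tau> p v * connection_form \<kappa> \<tau> p w"

section \<open>Circles and circular cylinders\<close>

definition rot90 :: "real^2 \<Rightarrow> real^2" where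
  "rot90 v = vector [- (v$2), v$1]"

text \<open>The geodesic curvature of a unit speed curve, with respect to its left normal.\<close>

definition geodesic_curvature :: "real \<Rightarrow> (real \<Rightarrow> real^2) \<Rightarrow> real \<Rightarrow> real" where
  "geodesic_curvature \<kappa> \<alpha> t =
     M2_metric \<kappa> (\<alpha> t) (cov_accel (M2_metric \<kappa>) \<alpha> t) (rot90 (vector_derivative \<alpha> (at t)))"

text \<open>\<open>\<alpha>\<close> is an arc length parametrization, of period \<open>\<l>\<close>, of a circle of geodesic curvature \<open>k\<close>. The
  sign of \<open>k\<close> fixes the sense in which \<open>\<alpha>\<close> runs through the circle.\<close>

definition is_circle :: "real \<Rightarrow> real \<Rightarrow> real \<Rightarrow> (real \<Rightarrow> real^2) \<Rightarrow> bool" where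
  "is_circle \<kappa> k \<l> \<alpha> \<longleftrightarrow>
     k > 0 \<and> (\<kappa> < 0 \<longrightarrow> k\<^sup>2 > - \<kappa>) \<and>
     smooth_on UNIV \<alpha> \<and> range \<alpha> \<subseteq> M2_domain \<kappa> \<and>
     \<l> > 0 \<and> (\<forall>t. \<alpha> (t + \<l>) = \<alpha> t) \<and> inj_on \<alpha> {0..<\<l>} \<and>
     (\<forall>t. M2_metric \<kappa> (\<alpha> t) (vector_derivative \<alpha> (at t)) (vector_derivative \<alpha> (at t)) = 1) \<and>
     (\<forall>t. geodesic_curvature \<kappa> \<alpha> t = k)"

text \<open>The slab \<open>0 \<le> z \<le> L\<close> refers to the coordinates of the model, and these are centred at the fiber
  over the origin. So the center of the circle is placed at the origin; this can be achieved by an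
  isometry of \<open>\<bbbE>(\<kappa>, \<tau>)\<close>, but such an isometry changes \<open>z\<close> by a nonconstant function of
  \<open>(x, y)\<close> when \<open>\<tau> \<noteq> 0\<close>.\<close>

definition radius_about_origin :: "real \<Rightarrow> (real \<Rightarrow> real^2) \<Rightarrow> real \<Rightarrow> bool" where
  "radius_about_origin \<kappa> \<alpha> \<rho> \<longleftrightarrow> (\<forall>t. geodesic_dist (M2_metric \<kappa>) (M2_domain \<kappa>) 0 (\<alpha> t) = \<rho>)"

definition cylinder :: "real \<Rightarrow> (real \<Rightarrow> real^2) \<Rightarrow> (real^3) set" where
  "cylinder \<kappa> \<alpha> = {p \<in> E_domain \<kappa>. fiber_proj p \<in> range \<alpha>}"

definition truncated_cylinder :: "real \<Rightarrow> (real \<Rightarrow> real^2) \<Rightarrow> real \<Rightarrow> (real^3) set" where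
  "truncated_cylinder \<kappa> \<alpha> L = {p \<in> cylinder \<kappa> \<alpha>. 0 \<le> p$3 \<and> p$3 \<le> L}"

definition truncated_cylinder_boundary :: "real \<Rightarrow> (real \<Rightarrow> real^2) \<Rightarrow> real \<Rightarrow> (real^3) set" where
  "truncated_cylinder_boundary \<kappa> \<alpha> L = {p \<in> cylinder \<kappa> \<alpha>. p$3 = 0 \<or> p$3 = L}"

definition cylinder_param :: "(real \<Rightarrow> real^2) \<Rightarrow> real^2 \<Rightarrow> real^3" where
  "cylinder_param \<alpha> q = vector [\<alpha> (q$1) $ 1, \<alpha> (q$1) $ 2, q$2]"

definition param_rectangle :: "real \<Rightarrow> real \<Rightarrow> (real^2) set" where
  "param_rectangle \<l> L = cbox 0 (vector [\<l>, L])"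

lemma mem_param_rectangle:
  "q \<in> param_rectangle \<l> L \<longleftrightarrow> 0 \<le> q$1 \<and> q$1 \<le> \<l> \<and> 0 \<le> q$2 \<and> q$2 \<le> L"
  by (auto simp: param_rectangle_def mem_box_cart forall_2)

lemma periodic_reduce:
  fixes \<alpha> :: "real \<Rightarrow> 'a"
  assumes "\<l> > 0" and per: "\<And>t. \<alpha> (t + \<l>) = \<alpha> t"
  obtains s where "0 \<le> s" "s < \<l>" "\<alpha> s = \<alpha> t"
proof -
  have n: "\<alpha> (t + real n * \<l>) = \<alpha> t" for t n
  proof (induction n)
    case (Suc n)
    have "t + real (Suc n) * \<l> = (t + real n * \<l>) + \<l>" by (simp add: algebra_simps)
    then show ?case using per Suc by metis
  qed simp
  have i: "\<alpha> (t + of_int m * \<l>) = \<alpha> t" for t m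
  proof (cases "m \<ge> 0")
    case True
    then show ?thesis using n[of t "nat m"] by simp
  next
    case False
    then show ?thesis using n[of "t + of_int m * \<l>" "nat (- m)"] by simp
  qed
  define m where "m = \<lfloor>t / \<l>\<rfloor>"
  have "of_int m \<le> t / \<l>" "t / \<l> < of_int m + 1" unfolding m_def by linarith+
  then have "of_int m * \<l> \<le> t" "t < (of_int m + 1) * \<l>"
    using \<open>\<l> > 0\<close> by (simp_all add: pos_le_divide_eq pos_divide_less_eq)
  then have "0 \<le> t + of_int (- m) * \<l>" "t + of_int (- m) * \<l> < \<l>"
    by (simp_all add: algebra_simps)
  then show ?thesis using that i by blast
qed

text \<open>The parametrization covers the truncated cylinder, and away from the seam and the boundary it
  is injective.\<close>

lemma cylinder_param_image:
  assumes "is_circle \<kappa> k \<l> \<alpha>"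
  shows "cylinder_param \<alpha> ` param_rectangle \<l> L = truncated_cylinder \<kappa> \<alpha> L" (is "?l = ?r")
proof
  have dom: "\<alpha> t \<in> M2_domain \<kappa>" for t
    using assms by (auto simp: is_circle_def)
  have proj: "fiber_proj (cylinder_param \<alpha> q) = \<alpha> (q$1)" for q
    by (simp add: fiber_proj_def cylinder_param_def vec_eq_iff forall_2)
  show "?l \<subseteq> ?r"
    using dom proj by (auto simp: truncated_cylinder_def cylinder_def E_domain_def
        mem_param_rectangle) (simp_all add: cylinder_param_def)
  show "?r \<subseteq> ?l"
  proof
    fix p assume p: "p \<in> ?r"
    then obtain t where t: "fiber_proj p = \<alpha> t" and z: "0 \<le> p$3" "p$3 \<le> L"
      by (auto simp: truncated_cylinder_def cylinder_def)
    obtain s where s: "0 \<le> s" "s < \<l>" "\<alpha> s = \<alpha> t"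
      using periodic_reduce[of \<l> \<alpha> t] assms by (auto simp: is_circle_def)
    have "p$1 = \<alpha> s $ 1" "p$2 = \<alpha> s $ 2"
      using t s(3) by (metis fiber_proj_def vector_2)+
    then have "p = cylinder_param \<alpha> (vector [s, p$3])"
      by (simp add: cylinder_param_def vec_eq_iff forall_3)
    moreover have "vector [s, p$3] \<in> param_rectangle \<l> L"
      using s z by (simp add: mem_param_rectangle)
    ultimately show "p \<in> ?l" by blast
  qed
qed

lemma cylinder_param_inj:
  assumes "is_circle \<kappa> k \<l> \<alpha>"
  shows "inj_on (cylinder_param \<alpha>) {q. 0 \<le> q$1 \<and> q$1 < \<l>}"
proof (rule inj_onI)
  fix q r :: "real^2"
  assume q: "q \<in> {q. 0 \<le> q$1 \<and> q$1 < \<l>}" and r: "r \<in> {q. 0 \<le> q$1 \<and> q$1 < \<l>}"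
    and eq: "cylinder_param \<alpha> q = cylinder_param \<alpha> r"
  from eq have "\<alpha> (q$1) = \<alpha> (r$1)" "q$2 = r$2"
    by (simp_all add: cylinder_param_def vec_eq_iff forall_2 forall_3)
  moreover have "inj_on \<alpha> {0..<\<l>}" using assms by (simp add: is_circle_def)
  ultimately show "q = r" using q r by (auto simp: vec_eq_iff forall_2 inj_on_def)
qed

definition critical_height :: "real \<Rightarrow> real \<Rightarrow> real \<Rightarrow> real" where
  "critical_height \<kappa> \<tau> \<rho> =
     (if \<kappa> < 0 then 2 * pi / (- \<kappa>) * sinh (\<rho> * sqrt (- \<kappa>)) *
        sqrt (- \<kappa> + 4 * \<tau>\<^sup>2 * (tanh (\<rho> * sqrt (- \<kappa>) / 2))\<^sup>2)
      else if \<kappa> = 0 then 2 * pi * \<rho> * sqrt (1 + \<tau>\<^sup>2 * \<rho>\<^sup>2)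
      else 2 * pi / \<kappa> * sin (\<rho> * sqrt \<kappa>) *
        sqrt (\<kappa> + 4 * \<tau>\<^sup>2 * (tan (\<rho> * sqrt \<kappa> / 2))\<^sup>2))"

end

theory Submission
  imports Defs
begin

text \<open>The test function is \<open>u = sin (2 * pi * z / L)\<close>, which vanishes at both ends and has mean
  zero. The distance hypothesis forces \<open>\<alpha>\<close> to run on a Euclidean circle of some radius \<open>r\<close> about the
  origin, with constant angular velocity \<open>c\<close> and \<open>\<bar>c\<bar> * \<sigma> * r = 1\<close>. In the parameters the cylinder is
  then flat with constant metric coefficients of determinant \<open>1\<close>, its potential \<open>|A|\<^sup>2 + Ric(N)\<close> is
  the constant \<open>c\<^sup>2\<close>, and on functions of \<open>z\<close> alone the Jacobi operator is
  \<open>(1 + \<tau>\<^sup>2 * r\<^sup>2) * f'' + c\<^sup>2 * f\<close>. So \<open>u\<close> is an eigenfunction, and its index is negative as soon as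
  \<open>L > 2 * pi * \<sigma> * r * sqrt (1 + \<tau>\<^sup>2 * r\<^sup>2)\<close>, which is the critical height for
  \<open>r = (2 / sqrt \<kappa>) * tan (\<rho> * sqrt \<kappa> / 2)\<close> and its analogues for \<open>\<kappa> \<le> 0\<close>.\<close>

section \<open>Partial derivatives\<close>

lemma partial_eqI: "(f has_derivative f') (at p) \<Longrightarrow> partial i f p = f' (axis i 1)"
  unfolding partial_def by (metis frechet_derivative_at)

lemma partial_const: "partial i (\<lambda>q. a) p = 0"
  by (rule partial_eqI) (auto intro!: derivative_eq_intros)

lemma partial_nth: "partial i (\<lambda>q. q $ j) p = (axis i 1 :: real^'n) $ j"
  by (rule partial_eqI) (auto intro!: bounded_linear_imp_has_derivative)

lemma differentiable_nth: "(\<lambda>q::real^'n. q $ j) differentiable (at p)"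
  by (intro bounded_linear_imp_differentiable bounded_linear_vec_nth)

lemma partial_add:
  assumes "f differentiable (at p)" "h differentiable (at p)"
  shows "partial i (\<lambda>q. f q + h q) p = partial i f p + partial i h p"
  using partial_eqI[OF has_derivative_add[OF assms[unfolded frechet_derivative_works]]]
  by (simp add: partial_def)

lemma partial_diff:
  assumes "f differentiable (at p)" "h differentiable (at p)"
  shows "partial i (\<lambda>q. f q - h q) p = partial i f p - partial i h p"
  using partial_eqI[OF has_derivative_diff[OF assms[unfolded frechet_derivative_works]]]
  by (simp add: partial_def)

lemma partial_minus:
  assumes "f differentiable (at p)"
  shows "partial i (\<lambda>q. - f q) p = - partial i f p"
  using partial_eqI[OF has_derivative_minus[OF assms[unfolded frechet_derivative_works]]]
  by (simp add: partial_def)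

lemma partial_mult:
  fixes f h :: "real^'n \<Rightarrow> real"
  assumes "f differentiable (at p)" "h differentiable (at p)"
  shows "partial i (\<lambda>q. f q * h q) p = f p * partial i h p + partial i f p * h p"
  using partial_eqI[OF has_derivative_mult[OF assms[unfolded frechet_derivative_works]]]
  by (simp add: partial_def)

lemma partial_power2:
  fixes f :: "real^'n \<Rightarrow> real"
  assumes "f differentiable (at p)"
  shows "partial i (\<lambda>q. (f q)\<^sup>2) p = 2 * f p * partial i f p"
  using partial_mult[OF assms assms] by (simp add: power2_eq_square)

lemma partial_divide_const:
  fixes f :: "real^'n \<Rightarrow> real"
  assumes "f differentiable (at p)"
  shows "partial i (\<lambda>q. f q / a) p = partial i f p / a"
  using partial_mult[OF assms, of "\<lambda>_. inverse a"] by (simp add: divide_inverse partial_const)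

lemma partial_cong:
  assumes "open S" "p \<in> S" "\<And>q. q \<in> S \<Longrightarrow> f q = h q"
  shows "partial i f p = partial i h p"
proof -
  \<comment> \<open>Both functions have the same set of derivatives at \<open>p\<close>, so the
    choice operator in \<open>frechet_derivative\<close> selects the same map even if that set is
    empty.\<close>
  have "(f has_derivative D) (at p) \<longleftrightarrow> (h has_derivative D) (at p)" for D
    using assms by (metis has_derivative_transform_within_open)
  then show ?thesis unfolding partial_def frechet_derivative_def by simp
qed

lemmas partial_rules = partial_const partial_nth partial_add partial_diff partial_minus
  partial_mult partial_power2 partial_divide_const differentiable_nth

lemma axis_3 [simp]:
  "axis (1::3) a $ 2 = (0::real)" "axis (1::3) a $ 3 = (0::real)"
  "axis (2::3) a $ 1 = (0::real)" "axis (2::3) a $ 3 = (0::real)"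
  "axis (3::3) a $ 1 = (0::real)" "axis (3::3) a $ 2 = (0::real)"
  by (simp_all add: axis_def)

lemma axis_2 [simp]:
  "axis (1::2) a $ 2 = (0::real)" "axis (2::2) a $ 1 = (0::real)"
  by (simp_all add: axis_def)

text \<open>A right inverse of a square matrix is two-sided. Hence the choice in
  \<open>matrix_inv\<close> has a witness, and inverses are unique.\<close>

lemma matrix_inv_eqI:
  fixes A B :: "real^'n^'n"
  assumes "A ** B = mat 1"
  shows "matrix_inv A = B"
proof -
  have "B ** A = mat 1" using assms matrix_left_right_inverse by blast
  with assms have "A ** matrix_inv A = mat 1"
    unfolding matrix_inv_def by (rule_tac someI2[of _ B]) auto
  then show ?thesis
    by (metis \<open>B ** A = mat 1\<close> matrix_mul_assoc matrix_mul_lid matrix_mul_rid)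
qed

section \<open>Curvature of \<open>\<bbbE>(\<kappa>, \<tau>)\<close>\<close>

text \<open>The conformal factor pulled back to \<open>real^3\<close>. It is kept as an atom, so
  that the curvature computation is polynomial algebra in it and the coordinates once denominators
  are cleared.\<close>

definition E_sigma :: "real \<Rightarrow> real^3 \<Rightarrow> real" where
  "E_sigma \<kappa> p = conf_factor \<kappa> (fiber_proj p)"

lemma E_sigma_eq: "E_sigma \<kappa> p = 4 / (4 + \<kappa> * ((p$1)\<^sup>2 + (p$2)\<^sup>2))"
  by (simp add: E_sigma_def conf_factor_def fiber_proj_def)

lemma M2_domain_pos: "p \<in> M2_domain \<kappa> \<Longrightarrow> 4 + \<kappa> * ((p$1)\<^sup>2 + (p$2)\<^sup>2) > 0"
proof (cases "\<kappa> < 0")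
  case True
  then show "p \<in> M2_domain \<kappa> \<Longrightarrow> ?thesis" by (simp add: M2_domain_def field_simps)
next
  case False
  then have "\<kappa> * ((p$1)\<^sup>2 + (p$2)\<^sup>2) \<ge> 0" by simp
  then show ?thesis by linarith
qed

lemma E_domain_pos: "p \<in> E_domain \<kappa> \<Longrightarrow> 4 + \<kappa> * ((p$1)\<^sup>2 + (p$2)\<^sup>2) > 0"
  using M2_domain_pos[of "fiber_proj p" \<kappa>] by (simp add: E_domain_def fiber_proj_def)

lemma open_E_domain: "open (E_domain \<kappa>)"
proof -
  have "E_domain \<kappa> = {p. \<kappa> < 0 \<longrightarrow> (p$1)\<^sup>2 + (p$2)\<^sup>2 < 4 / (- \<kappa>)}"
    by (simp add: E_domain_def M2_domain_def fiber_proj_def)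
  moreover have "open {p::real^3. (p$1)\<^sup>2 + (p$2)\<^sup>2 < 4 / (- \<kappa>)}"
    by (intro open_Collect_less continuous_intros)
  ultimately show ?thesis by (cases "\<kappa> < 0") auto
qed

text \<open>Expressing the derivative through the square of the factor itself keeps the polynomials
  in \<open>E_sigma\<close> and the coordinates closed under differentiation.\<close>

lemma E_sigma_has_derivative:
  assumes "p \<in> E_domain \<kappa>"
  shows "(E_sigma \<kappa> has_derivative
    (\<lambda>h. - (\<kappa> / 2) * (E_sigma \<kappa> p)\<^sup>2 * (p$1 * h$1 + p$2 * h$2))) (at p)"
proof -
  have pos: "4 + \<kappa> * ((p$1)\<^sup>2 + (p$2)\<^sup>2) \<noteq> 0" using E_domain_pos[OF assms] by simp
  have "((\<lambda>p::real^3. 4 / (4 + \<kappa> * ((p$1)\<^sup>2 + (p$2)\<^sup>2))) has_derivative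
    (\<lambda>h. - (\<kappa> / 2) * (4 / (4 + \<kappa> * ((p$1)\<^sup>2 + (p$2)\<^sup>2)))\<^sup>2 * (p$1 * h$1 + p$2 * h$2))) (at p)"
    using pos by (auto intro!: derivative_eq_intros bounded_linear_imp_has_derivative
      simp: divide_simps power2_eq_square) (simp add: algebra_simps)?
  then show ?thesis by (simp add: E_sigma_eq[abs_def])
qed

lemma E_sigma_differentiable: "p \<in> E_domain \<kappa> \<Longrightarrow> E_sigma \<kappa> differentiable (at p)"
  using E_sigma_has_derivative by (auto simp: differentiable_def)

lemma partial_E_sigma:
  assumes "p \<in> E_domain \<kappa>"
  shows "partial i (E_sigma \<kappa>) p =
    - (\<kappa> / 2) * (E_sigma \<kappa> p)\<^sup>2 * (p$1 * axis i 1 $ 1 + p$2 * axis i 1 $ 2)"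
  by (rule partial_eqI[OF E_sigma_has_derivative[OF assms]])

section \<open>Metric coefficients, inverse metric and Christoffel symbols\<close>

lemma gram_E_metric:
  "gram (E_metric \<kappa> \<tau>) q $ 1 $ 1 = (E_sigma \<kappa> q)\<^sup>2 + (E_sigma \<kappa> q * \<tau> * q$2)\<^sup>2"
  "gram (E_metric \<kappa> \<tau>) q $ 1 $ 2 = - (E_sigma \<kappa> q * \<tau>)\<^sup>2 * q$1 * q$2"
  "gram (E_metric \<kappa> \<tau>) q $ 1 $ 3 = E_sigma \<kappa> q * \<tau> * q$2"
  "gram (E_metric \<kappa> \<tau>) q $ 2 $ 1 = - (E_sigma \<kappa> q * \<tau>)\<^sup>2 * q$1 * q$2"
  "gram (E_metric \<kappa> \<tau>) q $ 2 $ 2 = (E_sigma \<kappa> q)\<^sup>2 + (E_sigma \<kappa> q * \<tau> * q$1)\<^sup>2"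
  "gram (E_metric \<kappa> \<tau>) q $ 2 $ 3 = - (E_sigma \<kappa> q * \<tau> * q$1)"
  "gram (E_metric \<kappa> \<tau>) q $ 3 $ 1 = E_sigma \<kappa> q * \<tau> * q$2"
  "gram (E_metric \<kappa> \<tau>) q $ 3 $ 2 = - (E_sigma \<kappa> q * \<tau> * q$1)"
  "gram (E_metric \<kappa> \<tau>) q $ 3 $ 3 = 1"
  by (simp_all add: gram_def E_metric_def M2_metric_def connection_form_def fiber_proj_def
      power2_eq_square E_sigma_def)

text \<open>With \<sigma> the conformal factor, the inverse metric is the sum of the tensor squares
  of the orthonormal frame (\<partial>x - \<sigma> \<tau> y \<partial>z) / \<sigma>, (\<partial>y +
  \<sigma> \<tau> x \<partial>z) / \<sigma>, \<partial>z.\<close>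

lemma gram_inv_E_metric_matrix:
  assumes "p \<in> E_domain \<kappa>"
  shows "gram_inv (E_metric \<kappa> \<tau>) p =
    vector [vector [1 / (E_sigma \<kappa> p)\<^sup>2, 0, - \<tau> * p$2 / E_sigma \<kappa> p],
            vector [0, 1 / (E_sigma \<kappa> p)\<^sup>2, \<tau> * p$1 / E_sigma \<kappa> p],
            vector [- \<tau> * p$2 / E_sigma \<kappa> p, \<tau> * p$1 / E_sigma \<kappa> p,
              1 + \<tau>\<^sup>2 * ((p$1)\<^sup>2 + (p$2)\<^sup>2)]]"
proof (rule matrix_inv_eqI)
  have "E_sigma \<kappa> p \<noteq> 0" using E_domain_pos[OF assms] by (simp add: E_sigma_eq)
  then show "gram (E_metric \<kappa> \<tau>) p ** vector [vector [1 / (E_sigma \<kappa> p)\<^sup>2, 0, - \<tau> * p$2 / E_sigma \<kappa> p],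
            vector [0, 1 / (E_sigma \<kappa> p)\<^sup>2, \<tau> * p$1 / E_sigma \<kappa> p],
            vector [- \<tau> * p$2 / E_sigma \<kappa> p, \<tau> * p$1 / E_sigma \<kappa> p,
              1 + \<tau>\<^sup>2 * ((p$1)\<^sup>2 + (p$2)\<^sup>2)]] = mat 1"
    by (simp add: vec_eq_iff forall_3 matrix_matrix_mult_def sum_3 gram_E_metric mat_def)
      (simp add: field_simps power2_eq_square)
qed

lemma gram_inv_E_metric:
  assumes "p \<in> E_domain \<kappa>"
  shows
    "gram_inv (E_metric \<kappa> \<tau>) p $ 1 $ 1 = 1 / (E_sigma \<kappa> p)\<^sup>2"
    "gram_inv (E_metric \<kappa> \<tau>) p $ 1 $ 2 = 0"
    "gram_inv (E_metric \<kappa> \<tau>) p $ 1 $ 3 = - \<tau> * p$2 / E_sigma \<kappa> p"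
    "gram_inv (E_metric \<kappa> \<tau>) p $ 2 $ 1 = 0"
    "gram_inv (E_metric \<kappa> \<tau>) p $ 2 $ 2 = 1 / (E_sigma \<kappa> p)\<^sup>2"
    "gram_inv (E_metric \<kappa> \<tau>) p $ 2 $ 3 = \<tau> * p$1 / E_sigma \<kappa> p"
    "gram_inv (E_metric \<kappa> \<tau>) p $ 3 $ 1 = - \<tau> * p$2 / E_sigma \<kappa> p"
    "gram_inv (E_metric \<kappa> \<tau>) p $ 3 $ 2 = \<tau> * p$1 / E_sigma \<kappa> p"
    "gram_inv (E_metric \<kappa> \<tau>) p $ 3 $ 3 = 1 + \<tau>\<^sup>2 * ((p$1)\<^sup>2 + (p$2)\<^sup>2)"
  by (simp_all add: gram_inv_E_metric_matrix[OF assms])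

text \<open>The equation that defines the conformal factor, cleared of its denominator: the
  polynomial relation modulo which the Groebner basis steps work.\<close>

lemma E_sigma_relation:
  assumes "p \<in> E_domain \<kappa>"
  shows "E_sigma \<kappa> p * \<kappa> * (p$1)\<^sup>2 = 4 - 4 * E_sigma \<kappa> p - E_sigma \<kappa> p * \<kappa> * (p$2)\<^sup>2"
proof -
  have "E_sigma \<kappa> p * (4 + \<kappa> * ((p$1)\<^sup>2 + (p$2)\<^sup>2)) = 4"
    using E_domain_pos[OF assms] by (simp add: E_sigma_eq del: distrib_left_numeral)
  then show ?thesis by (simp add: algebra_simps)
qed

lemma E_sigma_nonzero: "p \<in> E_domain \<kappa> \<Longrightarrow> E_sigma \<kappa> p \<noteq> 0"
  using E_domain_pos[of p \<kappa>] by (simp add: E_sigma_eq)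

text \<open>Only lower indices in increasing order are computed; symmetry of the metric gives the
  others.\<close>

lemma christoffel_E_metric:
  assumes "p \<in> E_domain \<kappa>"
  shows
    "christoffel (E_metric \<kappa> \<tau>) 1 1 1 p = - (\<kappa> / 2) * E_sigma \<kappa> p * p$1"
    "christoffel (E_metric \<kappa> \<tau>) 1 1 2 p = (\<tau>\<^sup>2 - \<kappa> / 2) * E_sigma \<kappa> p * p$2"
    "christoffel (E_metric \<kappa> \<tau>) 1 1 3 p = 0"
    "christoffel (E_metric \<kappa> \<tau>) 1 2 2 p = (\<kappa> / 2 - 2 * \<tau>\<^sup>2) * E_sigma \<kappa> p * p$1"
    "christoffel (E_metric \<kappa> \<tau>) 1 2 3 p = \<tau>"
    "christoffel (E_metric \<kappa> \<tau>) 1 3 3 p = 0"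
    "christoffel (E_metric \<kappa> \<tau>) 2 1 1 p = (\<kappa> / 2 - 2 * \<tau>\<^sup>2) * E_sigma \<kappa> p * p$2"
    "christoffel (E_metric \<kappa> \<tau>) 2 1 2 p = (\<tau>\<^sup>2 - \<kappa> / 2) * E_sigma \<kappa> p * p$1"
    "christoffel (E_metric \<kappa> \<tau>) 2 1 3 p = - \<tau>"
    "christoffel (E_metric \<kappa> \<tau>) 2 2 2 p = - (\<kappa> / 2) * E_sigma \<kappa> p * p$2"
    "christoffel (E_metric \<kappa> \<tau>) 2 2 3 p = 0"
    "christoffel (E_metric \<kappa> \<tau>) 2 3 3 p = 0"
    "christoffel (E_metric \<kappa> \<tau>) 3 1 1 p = \<tau> * (\<kappa> / 2 - 2 * \<tau>\<^sup>2) * (E_sigma \<kappa> p)\<^sup>2 * p$1 * p$2"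
    "christoffel (E_metric \<kappa> \<tau>) 3 1 2 p =
       \<tau> * (\<kappa> / 4 - \<tau>\<^sup>2) * (E_sigma \<kappa> p)\<^sup>2 * ((p$2)\<^sup>2 - (p$1)\<^sup>2)"
    "christoffel (E_metric \<kappa> \<tau>) 3 1 3 p = - \<tau>\<^sup>2 * E_sigma \<kappa> p * p$1"
    "christoffel (E_metric \<kappa> \<tau>) 3 2 2 p = - \<tau> * (\<kappa> / 2 - 2 * \<tau>\<^sup>2) * (E_sigma \<kappa> p)\<^sup>2 * p$1 * p$2"
    "christoffel (E_metric \<kappa> \<tau>) 3 2 3 p = - \<tau>\<^sup>2 * E_sigma \<kappa> p * p$2"
    "christoffel (E_metric \<kappa> \<tau>) 3 3 3 p = 0"
  \<comment> \<open>Once the denominators are cleared, the goals that remain are polynomial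
    identities modulo \<open>E_sigma_relation\<close>.\<close>
  by (simp add: christoffel_def sum_3 gram_inv_E_metric[OF assms] gram_E_metric partial_rules
      partial_E_sigma[OF assms] E_sigma_differentiable[OF assms];
    (use E_sigma_nonzero[OF assms] in \<open>simp add: field_simps eval_nat_numeral\<close>)?;
    (use E_sigma_relation[OF assms] in algebra)?)+

section \<open>Remaining Christoffel symbols and their derivatives\<close>

lemma gram_symmetric:
  assumes "\<And>p v w. g p v w = g p w v"
  shows "gram g p $ i $ j = gram g p $ j $ i"
  using assms by (simp add: gram_def)

lemma christoffel_symmetric:
  assumes "\<And>p v w. g p v w = g p w v"
  shows "christoffel g k i j p = christoffel g k j i p"
  unfolding christoffel_def using gram_symmetric[of g, OF assms] by (simp add: algebra_simps)

lemma E_metric_symmetric: "E_metric \<kappa> \<tau> p v w = E_metric \<kappa> \<tau> p w v"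
  by (simp add: E_metric_def M2_metric_def algebra_simps)

lemmas christoffel_E_metric_symmetric =
  christoffel_symmetric[of "E_metric \<kappa> \<tau>" for \<kappa> \<tau>, OF E_metric_symmetric]

lemma christoffel_E_metric':
  assumes "p \<in> E_domain \<kappa>"
  shows
    "christoffel (E_metric \<kappa> \<tau>) 1 2 1 p = (\<tau>\<^sup>2 - \<kappa> / 2) * E_sigma \<kappa> p * p$2"
    "christoffel (E_metric \<kappa> \<tau>) 1 3 1 p = 0"
    "christoffel (E_metric \<kappa> \<tau>) 1 3 2 p = \<tau>"
    "christoffel (E_metric \<kappa> \<tau>) 2 2 1 p = (\<tau>\<^sup>2 - \<kappa> / 2) * E_sigma \<kappa> p * p$1"
    "christoffel (E_metric \<kappa> \<tau>) 2 3 1 p = - \<tau>"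
    "christoffel (E_metric \<kappa> \<tau>) 2 3 2 p = 0"
    "christoffel (E_metric \<kappa> \<tau>) 3 2 1 p =
       \<tau> * (\<kappa> / 4 - \<tau>\<^sup>2) * (E_sigma \<kappa> p)\<^sup>2 * ((p$2)\<^sup>2 - (p$1)\<^sup>2)"
    "christoffel (E_metric \<kappa> \<tau>) 3 3 1 p = - \<tau>\<^sup>2 * E_sigma \<kappa> p * p$1"
    "christoffel (E_metric \<kappa> \<tau>) 3 3 2 p = - \<tau>\<^sup>2 * E_sigma \<kappa> p * p$2"
  using christoffel_E_metric[OF assms, of \<tau>] christoffel_E_metric_symmetric by metis+

lemmas christoffel_E = christoffel_E_metric christoffel_E_metric'

text \<open>The closed forms hold on the whole open domain and not just at \<open>p\<close>, so they
  may be differentiated there.\<close>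

lemma partial_christoffel_E:
  assumes "p \<in> E_domain \<kappa>" "\<And>q. q \<in> E_domain \<kappa> \<Longrightarrow> christoffel (E_metric \<kappa> \<tau>) l i j q = f q"
  shows "partial m (christoffel (E_metric \<kappa> \<tau>) l i j) p = partial m f p"
  using assms open_E_domain partial_cong by blast

lemmas partial_christoffel_E_rules = christoffel_E[THEN partial_christoffel_E[rotated], rotated]

text \<open>The Ricci form is \<kappa> - 2 \<tau>^2 times the metric on horizontal vectors and 2
  \<tau>^2 on the unit fiber direction. A coordinate vector \<open>vector [a, b, 0]\<close> is in
  general not horizontal: its fiber component is
  \<open>E_sigma \<kappa> p * \<tau> * (p$2 * a - p$1 * b)\<close>, which accounts for the quartic
  term in \<tau>.\<close>

lemma ricci_E_metric_horizontal:
  assumes p: "p \<in> E_domain \<kappa>"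
  shows "ricci (E_metric \<kappa> \<tau>) p (vector [a, b, 0]) (vector [a, b, 0]) =
    (E_sigma \<kappa> p)\<^sup>2 * ((\<kappa> - 2 * \<tau>\<^sup>2) * (a\<^sup>2 + b\<^sup>2) + 2 * \<tau>^4 * (p$2 * a - p$1 * b)\<^sup>2)"
proof -
  \<comment> \<open>In terms of \<open>\<kappa> / 4\<close> no fractions occur, as the Groebner basis method requires.\<close>
  define m where "m = \<kappa> / 4"
  then have m: "\<kappa> = 4 * m" by simp
  define s x y where "s = E_sigma \<kappa> p" and "x = p$1" and "y = p$2"
  note fold = s_def[symmetric] x_def[symmetric] y_def[symmetric]
  have rel: "s * m * x\<^sup>2 = 1 - s - s * m * y\<^sup>2"
    using E_sigma_relation[OF p] unfolding fold by (simp add: m)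
  note expand = ricci_def riemann_def sum_3 christoffel_E[OF p] partial_christoffel_E_rules[OF p]
    partial_rules partial_E_sigma[OF p] E_sigma_differentiable[OF p]
  show ?thesis
    by (simp add: expand, simp only: fold, unfold m, simp, use rel in algebra)
qed

section \<open>The Jacobi operator of a cylinder over a circle\<close>

lemma vector_3_eq_scaleR:
  "(vector [a, b, d] :: real^3) = a *\<^sub>R axis 1 1 + b *\<^sub>R axis 2 1 + d *\<^sub>R axis 3 1"
  by (simp add: vec_eq_iff forall_3)

lemma has_derivative_vector_3:
  assumes "(f has_derivative f') F" "(g has_derivative g') F" "(h has_derivative h') F"
  shows "((\<lambda>q. vector [f q, g q, h q] :: real^3) has_derivative (\<lambda>v. vector [f' v, g' v, h' v])) F"
  unfolding vector_3_eq_scaleR using assms by (intro derivative_intros)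

lemma has_derivative_comp_nth:
  assumes "(f has_real_derivative f') (at (q $ j))"
  shows "((\<lambda>q::real^'n. f (q $ j)) has_derivative (\<lambda>h. f' * h $ j)) (at q)"
proof -
  have "((\<lambda>q::real^'n. q $ j) has_derivative (\<lambda>h. h $ j)) (at q)"
    by (intro bounded_linear_imp_has_derivative bounded_linear_vec_nth)
  from has_derivative_compose[OF this] assms show ?thesis
    by (simp add: has_field_derivative_def)
qed

text \<open>Uniform rotation about the origin on the circle of Euclidean radius \<open>r\<close>:
  \<open>c\<close> is the angular velocity and \<open>s\<close> the constant value of the conformal
  factor. Unit speed enters squared, so \<open>c\<close> may have either sign.\<close>

locale round_cylinder =
  fixes \<kappa> \<tau> c r s :: real and \<alpha> :: "real \<Rightarrow> real^2"
  assumes curve_deriv: "(\<alpha> has_vector_derivative c *\<^sub>R rot90 (\<alpha> t)) (at t)"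
    and curve_norm: "(\<alpha> t $ 1)\<^sup>2 + (\<alpha> t $ 2)\<^sup>2 = r\<^sup>2"
    and curve_dom: "\<alpha> t \<in> M2_domain \<kappa>"
    and s_eq: "s = 4 / (4 + \<kappa> * r\<^sup>2)"
    and unit_speed: "c\<^sup>2 * s\<^sup>2 * r\<^sup>2 = 1"
begin

abbreviation "X \<equiv> cylinder_param \<alpha>"
abbreviation "g \<equiv> E_metric \<kappa> \<tau>"
text \<open>The value of the connection form on the first tangent vector, hence the mixed
  coefficient of the induced metric.\<close>

definition "e = - s * \<tau> * c * r\<^sup>2"

lemma s_pos: "s > 0"
  using M2_domain_pos[OF curve_dom, of undefined] unfolding s_eq curve_norm by simp

lemma s_relation: "s * \<kappa> * r\<^sup>2 = 4 - 4 * s"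
proof -
  have "4 + \<kappa> * r\<^sup>2 > 0"
    using M2_domain_pos[OF curve_dom, of undefined] unfolding curve_norm by simp
  then show ?thesis unfolding s_eq by (simp add: field_simps)
qed

lemma e_sq: "e\<^sup>2 = \<tau>\<^sup>2 * r\<^sup>2"
proof -
  have "e\<^sup>2 = (c\<^sup>2 * s\<^sup>2 * r\<^sup>2) * (\<tau>\<^sup>2 * r\<^sup>2)"
    by (simp add: e_def power_mult_distrib power2_eq_square)
  then show ?thesis by (simp add: unit_speed)
qed

lemma X_dom: "X q \<in> E_domain \<kappa>"
  using curve_dom[of "q$1"] by (simp add: E_domain_def fiber_proj_def cylinder_param_def M2_domain_def)

lemma X_sigma: "E_sigma \<kappa> (X q) = s"
  by (simp add: E_sigma_eq cylinder_param_def curve_norm s_eq)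

lemma X_nth [simp]: "X q $ 1 = \<alpha> (q$1) $ 1" "X q $ 2 = \<alpha> (q$1) $ 2" "X q $ 3 = q$2"
  by (simp_all add: cylinder_param_def)

section \<open>Tangent vectors and second derivatives of the parametrization\<close>

lemma curve_nth_deriv:
  "((\<lambda>t. \<alpha> t $ 1) has_real_derivative - c * \<alpha> t $ 2) (at t)"
  "((\<lambda>t. \<alpha> t $ 2) has_real_derivative c * \<alpha> t $ 1) (at t)"
proof -
  have "((\<lambda>t. \<alpha> t $ i) has_real_derivative (c *\<^sub>R rot90 (\<alpha> t)) $ i) (at t)" for i
    using bounded_linear.has_vector_derivative[OF bounded_linear_vec_nth curve_deriv]
    by (simp add: has_real_derivative_iff_has_vector_derivative)
  from this[of 1] this[of 2]
  show "((\<lambda>t. \<alpha> t $ 1) has_real_derivative - c * \<alpha> t $ 2) (at t)"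
    "((\<lambda>t. \<alpha> t $ 2) has_real_derivative c * \<alpha> t $ 1) (at t)"
    by (simp_all add: rot90_def)
qed

lemma X_has_derivative:
  "(X has_derivative (\<lambda>h. vector [- c * \<alpha> (q$1) $ 2 * h$1, c * \<alpha> (q$1) $ 1 * h$1, h$2])) (at q)"
proof -
  have "((\<lambda>q. q $ 2) has_derivative (\<lambda>h. h $ 2)) (at (q::real^2))"
    by (intro bounded_linear_imp_has_derivative bounded_linear_vec_nth)
  from has_derivative_vector_3[OF curve_nth_deriv[THEN has_derivative_comp_nth] this]
  show ?thesis by (simp add: cylinder_param_def[abs_def])
qed

lemma X_frechet:
  "frechet_derivative X (at q) =
    (\<lambda>h. vector [- c * \<alpha> (q$1) $ 2 * h$1, c * \<alpha> (q$1) $ 1 * h$1, h$2])"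
  by (rule frechet_derivative_at[OF X_has_derivative, symmetric])

lemma X_partial:
  "partial 1 X q = vector [- c * \<alpha> (q$1) $ 2, c * \<alpha> (q$1) $ 1, 0]"
  "partial 2 X q = vector [0, 0, 1]"
  using partial_eqI[OF X_has_derivative] by simp_all

lemma X_partial2:
  "partial 1 (partial 1 X) q = vector [- c\<^sup>2 * \<alpha> (q$1) $ 1, - c\<^sup>2 * \<alpha> (q$1) $ 2, 0]"
  "partial 2 (partial 1 X) q = 0"
  "partial i (partial 2 X) q = 0"
proof -
  have 2: "partial 2 X = (\<lambda>q. vector [0, 0, 1])" using X_partial(2) by blast
  show "partial i (partial 2 X) q = 0" unfolding 2 by (rule partial_const)
  have 1: "partial 1 X = (\<lambda>q. vector [- c * \<alpha> (q$1) $ 2, c * \<alpha> (q$1) $ 1, 0])"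
    using X_partial(1) by blast
  have "(partial 1 X has_derivative
    (\<lambda>h. vector [(- c) * (c * \<alpha> (q$1) $ 1 * h$1), c * (- c * \<alpha> (q$1) $ 2 * h$1), 0])) (at q)"
    unfolding 1
    by (intro has_derivative_vector_3 derivative_intros curve_nth_deriv[THEN has_derivative_comp_nth])
  from partial_eqI[OF this] show
    "partial 1 (partial 1 X) q = vector [- c\<^sup>2 * \<alpha> (q$1) $ 1, - c\<^sup>2 * \<alpha> (q$1) $ 2, 0]"
    "partial 2 (partial 1 X) q = 0"
    by (simp_all add: vec_eq_iff forall_3 power2_eq_square)
qed

lemma E_metric_eq:
  "g p v w = (E_sigma \<kappa> p)\<^sup>2 * (v$1 * w$1 + v$2 * w$2) +
    (E_sigma \<kappa> p * \<tau> * (p$2 * v$1 - p$1 * v$2) + v$3) *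
    (E_sigma \<kappa> p * \<tau> * (p$2 * w$1 - p$1 * w$2) + w$3)"
  by (simp add: E_metric_def M2_metric_def connection_form_def E_sigma_def fiber_proj_def)

text \<open>The first tangent vector is a horizontal vector, of unit length by
  \<open>unit_speed\<close>, plus \<open>e\<close> times the fiber direction; the second is the unit
  fiber direction itself.\<close>

lemma gram_first_form:
  "gram (first_form g X) q = vector [vector [1 + e\<^sup>2, e], vector [e, 1]]"
proof -
  define x y where "x = \<alpha> (q$1) $ 1" and "y = \<alpha> (q$1) $ 2"
  note fold = x_def[symmetric] y_def[symmetric]
  have r: "r\<^sup>2 = x\<^sup>2 + y\<^sup>2" unfolding x_def y_def using curve_norm by simp
  have "s\<^sup>2 * (c * x * (c * x) + c * y * (c * y)) = c\<^sup>2 * s\<^sup>2 * r\<^sup>2"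
    unfolding r by (simp add: algebra_simps power2_eq_square)
  \<comment> \<open>This equation and the next have the shape in which the expanded coefficients
    appear, so that they can be unfolded as rewrite rules.\<close>
  then have 1: "s\<^sup>2 * (c * y * (c * y) + c * x * (c * x)) = 1"
    unfolding unit_speed by (simp add: add.commute)
  have 2: "s * \<tau> * (- (y * (c * y)) - x * (c * x)) = e"
    unfolding e_def r by (simp add: algebra_simps power2_eq_square)
  show ?thesis
    by (simp add: vec_eq_iff forall_2 gram_def first_form_def X_frechet E_metric_eq X_sigma,
      unfold fold 1 2, simp add: power2_eq_square)
qed

lemma gram_inv_first_form:
  "gram_inv (first_form g X) q = vector [vector [1, - e], vector [- e, 1 + e\<^sup>2]]"
  by (rule matrix_inv_eqI)
    (simp add: gram_first_form vec_eq_iff forall_2 matrix_matrix_mult_def sum_2 mat_def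
      power2_eq_square)

lemma volume_density_first_form: "volume_density (first_form g X) q = 1"
  by (simp add: volume_density_def gram_first_form det_2 power2_eq_square)

text \<open>A radial vector annihilates the connection form, so it is horizontal;
  \<open>unit_speed\<close> gives it length 1. It points outwards exactly if \<open>c\<close> is
  positive.\<close>

lemma X_unit_normal: "unit_normal g X q = vector [c * \<alpha> (q$1) $ 1, c * \<alpha> (q$1) $ 2, 0]"
proof -
  let ?x = "\<alpha> (q$1) $ 1" and ?y = "\<alpha> (q$1) $ 2"
  let ?n = "gram_inv g (X q) *v cross3 (partial 1 X q) (partial 2 X q)"
  have n: "?n = vector [c * ?x / s\<^sup>2, c * ?y / s\<^sup>2, 0]"
    by (simp add: gram_inv_E_metric[OF X_dom] X_sigma X_partial matrix_vector_mult_def sum_3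
      vec_eq_iff forall_3 cross3_def)
  have "g (X q) ?n ?n = (c\<^sup>2 * s\<^sup>2 * (?x\<^sup>2 + ?y\<^sup>2)) / s^4"
    unfolding n using s_pos by (simp add: E_metric_eq X_sigma field_simps power2_eq_square eval_nat_numeral)
  also have "\<dots> = (1 / s\<^sup>2)\<^sup>2" by (simp add: curve_norm unit_speed power_one_over)
  finally have "sqrt (g (X q) ?n ?n) = 1 / s\<^sup>2" using s_pos by simp
  with n show ?thesis using s_pos by (simp add: unit_normal_def Let_def vec_eq_iff forall_3)
qed

text \<open>The first tangent vector is a unit horizontal vector plus \<open>e\<close> times the
  fiber direction. The horizontal part contributes \<open>c * (1 - 2 * s)\<close>, the geodesic
  curvature of the circle along the radial normal; the mixed part contributes
  \<open>2 * e * \<tau>\<close>; the fibers are geodesics and contribute nothing.\<close>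

lemma X_second_form:
  "second_form g X q 1 1 = c * (1 - 2 * s - 2 * \<tau>\<^sup>2 * s * r\<^sup>2)"
  "second_form g X q 1 2 = \<tau>"
  "second_form g X q 2 1 = \<tau>"
  "second_form g X q 2 2 = 0"
proof -
  define m where "m = \<kappa> / 4"
  then have m: "\<kappa> = 4 * m" by simp
  define x y where "x = \<alpha> (q$1) $ 1" and "y = \<alpha> (q$1) $ 2"
  note fold = x_def[symmetric] y_def[symmetric]
  have r: "r\<^sup>2 = x\<^sup>2 + y\<^sup>2" unfolding x_def y_def using curve_norm by simp
  have u: "c\<^sup>2 * s\<^sup>2 * (x\<^sup>2 + y\<^sup>2) = 1" using unit_speed r by simp
  have rel: "s * m * (x\<^sup>2 + y\<^sup>2) = 1 - s" using s_relation unfolding r by (simp add: m algebra_simps)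
  note expand = second_form_def X_partial X_partial2 X_unit_normal E_metric_eq X_sigma
    connection_term_def sum_3 christoffel_E[OF X_dom]
  show "second_form g X q 1 1 = c * (1 - 2 * s - 2 * \<tau>\<^sup>2 * s * r\<^sup>2)"
    by (simp add: expand, unfold fold r m, use rel u in algebra)
  show "second_form g X q 2 2 = 0" by (simp add: expand)
  show "second_form g X q 1 2 = \<tau>"
    by (simp add: expand, unfold fold, use u in algebra)
  show "second_form g X q 2 1 = \<tau>"
    by (simp add: expand, unfold fold, use u in algebra)
qed

text \<open>The twist adds 2 \<tau>^2 to the squared norm of the second form and subtracts the same
  from the Ricci term, so \<tau> cancels. What is left is the squared geodesic curvature of the
  circle plus \<kappa>.\<close>

lemma norm_sq_add_ricci:
  "norm_sq_second_form g X q + ricci g (X q) (unit_normal g X q) (unit_normal g X q) = c\<^sup>2"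
proof -
  have "ricci g (X q) (unit_normal g X q) (unit_normal g X q) = 
     s\<^sup>2 * ((\<kappa> - 2 * \<tau>\<^sup>2) * (c\<^sup>2 * ((\<alpha> (q$1) $ 1)\<^sup>2 + (\<alpha> (q$1) $ 2)\<^sup>2)))"
    by (simp add: X_unit_normal ricci_E_metric_horizontal[OF X_dom] X_sigma power_mult_distrib algebra_simps)
  also have "\<dots> = (c\<^sup>2 * s\<^sup>2 * r\<^sup>2) * (\<kappa> - 2 * \<tau>\<^sup>2)" by (simp add: curve_norm)
  also have "\<dots> = \<kappa> - 2 * \<tau>\<^sup>2" by (simp add: unit_speed)
  finally have ric: "ricci g (X q) (unit_normal g X q) (unit_normal g X q) = \<kappa> - 2 * \<tau>\<^sup>2" .
  have "norm_sq_second_form g X q = (c * (1 - 2 * s))\<^sup>2 + 2 * \<tau>\<^sup>2"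
    by (simp add: norm_sq_second_form_def sum_2 X_second_form gram_inv_first_form)
       (simp add: e_def power2_eq_square algebra_simps)
  \<comment> \<open>Unit speed and \<open>s_relation\<close> express \<kappa> through
    \<open>c\<close> and \<open>s\<close>; it is exactly the amount by which the squared geodesic
    curvature falls short of \<open>c\<^sup>2\<close>.\<close>
  moreover have "c\<^sup>2 * s * (4 - 4 * s) = c\<^sup>2 * s\<^sup>2 * r\<^sup>2 * \<kappa>"
    unfolding s_relation[symmetric] by (simp add: power2_eq_square)
  then have "c\<^sup>2 * s * (4 - 4 * s) = \<kappa>" by (simp only: unit_speed mult_1)
  moreover have "(c * (1 - 2 * s))\<^sup>2 = c\<^sup>2 - c\<^sup>2 * s * (4 - 4 * s)"
    by (simp add: power2_eq_square algebra_simps)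
  ultimately show ?thesis unfolding ric by linarith
qed

text \<open>The volume density is 1 and the inverse metric is constant, so on a function of the
  height the Laplacian reduces to the inverse coefficient \<open>1 + e\<^sup>2\<close> times the
  second derivative.\<close>

lemma jacobi_height:
  assumes f: "\<And>t. (f has_real_derivative f' t) (at t)" "\<And>t. (f' has_real_derivative f'' t) (at t)"
  shows "jacobi_operator g X (\<lambda>q. f (q$2)) q = (1 + \<tau>\<^sup>2 * r\<^sup>2) * f'' (q$2) + c\<^sup>2 * f (q$2)"
proof -
  have d: "partial i (\<lambda>q. f (q$2)) q = f' (q$2) * axis i 1 $ 2" for i and q :: "real^2"
    by (rule partial_eqI[OF has_derivative_comp_nth[OF f(1)]])
  have d': "partial i (\<lambda>q. f' (q$2)) q = f'' (q$2) * axis i 1 $ 2" for i and q :: "real^2"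
    by (rule partial_eqI[OF has_derivative_comp_nth[OF f(2)]])
  have diff: "(\<lambda>q. f' (q$2)) differentiable (at q)" for q :: "real^2"
    using has_derivative_comp_nth[OF f(2)] differentiable_def by blast
  show ?thesis
    by (simp add: jacobi_operator_def norm_sq_add_ricci laplace_beltrami_def
      volume_density_first_form sum_2 gram_inv_first_form d partial_rules diff d' e_sq)
qed

end

section \<open>Instability of long cylinders\<close>

text \<open>Writing the cosine as a shifted sine keeps the family closed under differentiation,
  which makes the induction for smoothness work.\<close>

lemma sin_height_deriv:
  "((\<lambda>p::real^'n. a * sin (w * p$i + d)) has_derivative
    (\<lambda>h. (a * w * h$i) * sin (w * p$i + (d + pi / 2)))) (at p)"
proof -
  have "((\<lambda>t. a * sin (w * t + d)) has_real_derivative a * (cos (w * t + d) * w)) (at t)" for t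
    by (auto intro!: derivative_eq_intros)
  from has_derivative_comp_nth[OF this] show ?thesis
    by (simp add: sin_add cos_add algebra_simps)
qed

lemma Ck_on_sin_height: "Ck_on k UNIV (\<lambda>p::real^'n. a * sin (w * p$i + d))"
proof (induction k arbitrary: a d)
  case 0
  show ?case by (simp, intro continuous_intros)
next
  case (Suc k)
  have "(\<lambda>p::real^'n. a * sin (w * p$i + d)) differentiable_on UNIV"
    unfolding differentiable_on_def differentiable_def using sin_height_deriv by blast
  moreover have "(\<lambda>x. frechet_derivative (\<lambda>p::real^'n. a * sin (w * p$i + d)) (at x) b) =
      (\<lambda>p. (a * w * b$i) * sin (w * p$i + (d + pi / 2)))" for b
    by (subst frechet_derivative_at[OF sin_height_deriv, symmetric]) (rule refl)
  ultimately show ?case using Suc by simp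
qed

text \<open>The point reflection in the centre preserves the rectangle and Lebesgue measure.
  Functions that are odd about the centre therefore have mean zero, without iterated
  integrals.\<close>

lemma integral_reflect_param_rectangle:
  fixes f :: "real^2 \<Rightarrow> 'a::banach"
  assumes "continuous_on (param_rectangle l L) f"
  shows "integral (param_rectangle l L) (\<lambda>q. f (vector [l, L] - q)) = integral (param_rectangle l L) f"
proof -
  have "(f has_integral integral (param_rectangle l L) f) (cbox 0 (vector [l, L]))"
    using assms unfolding param_rectangle_def by (intro integrable_integral integrable_continuous)
  from has_integral_affinity[OF this, of "-1" "vector [l, L]"]
  have "((\<lambda>q. f (vector [l, L] - q)) has_integral integral (param_rectangle l L) f)
    ((\<lambda>q. vector [l, L] - q) ` param_rectangle l L)"
    by (simp add: param_rectangle_def)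
  moreover have "(\<lambda>q. vector [l, L] - q) ` param_rectangle l L = param_rectangle l L"
  proof
    show "(\<lambda>q. vector [l, L] - q) ` param_rectangle l L \<subseteq> param_rectangle l L"
      by (auto simp: mem_param_rectangle)
    have "q = vector [l, L] - (vector [l, L] - q)" for q :: "real^2" by simp
    moreover have "vector [l, L] - q \<in> param_rectangle l L" if "q \<in> param_rectangle l L" for q
      using that by (auto simp: mem_param_rectangle)
    ultimately show "param_rectangle l L \<subseteq> (\<lambda>q. vector [l, L] - q) ` param_rectangle l L" by blast
  qed
  ultimately show ?thesis by (intro integral_unique) simp
qed

context round_cylinder
begin

lemma unstable:
  assumes "\<l> > 0" "L > 0" and long: "4 * pi\<^sup>2 * (1 + \<tau>\<^sup>2 * r\<^sup>2) < c\<^sup>2 * L\<^sup>2"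
  shows "\<not> stable_surface g X (param_rectangle \<l> L) (truncated_cylinder_boundary \<kappa> \<alpha> L)"
proof
  assume stable: "stable_surface g X (param_rectangle \<l> L) (truncated_cylinder_boundary \<kappa> \<alpha> L)"
  define w where "w = 2 * pi / L"
  define u :: "real^3 \<Rightarrow> real" where "u = (\<lambda>p. sin (w * p$3))"
  \<comment> \<open>The eigenvalue of the Jacobi operator on the test function; the hypothesis
    \<open>long\<close> says that it is positive.\<close>
  define \<mu> where "\<mu> = c\<^sup>2 - (1 + \<tau>\<^sup>2 * r\<^sup>2) * w\<^sup>2"
  let ?D = "param_rectangle \<l> L"
  have wL: "w * L = 2 * pi" using \<open>L > 0\<close> by (simp add: w_def)
  have "\<mu> > 0"
    using long \<open>L > 0\<close> by (simp add: \<mu>_def w_def field_simps power2_eq_square)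
  have uX: "u \<circ> X = (\<lambda>q. sin (w * q$2))" by (simp add: u_def fun_eq_iff)
  have "smooth_on UNIV u"
    using Ck_on_sin_height[of _ 1 w "3::3" 0] by (simp add: smooth_on_def u_def)
  moreover have "\<forall>p\<in>truncated_cylinder_boundary \<kappa> \<alpha> L. u p = 0"
    using wL by (auto simp: truncated_cylinder_boundary_def u_def)
  moreover have "surface_integral g X ?D (u \<circ> X) = 0"
  proof -
    \<comment> \<open>The test function runs through one full period, so it is odd about the middle
      height.\<close>
    have "sin (w * (L - z)) = - sin (w * z)" for z
      using wL by (simp add: right_diff_distrib sin_diff)
    moreover have "continuous_on ?D (\<lambda>q. sin (w * q$2))" by (intro continuous_intros)
    from integral_reflect_param_rectangle[OF this]
    have "integral ?D (\<lambda>q. sin (w * (L - q$2))) = integral ?D (\<lambda>q. sin (w * q$2))" by simp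
    ultimately have "integral ?D (\<lambda>q. sin (w * q$2)) = 0" by simp
    then show ?thesis by (simp add: surface_integral_def uX volume_density_first_form)
  qed
  ultimately have nonneg: "index_form g X ?D (u \<circ> X) \<ge> 0"
    using stable unfolding stable_surface_def by blast
  have "jacobi_operator g X (\<lambda>q. sin (w * q$2)) q = \<mu> * sin (w * q$2)" for q
  proof -
    have "((\<lambda>t. sin (w * t)) has_real_derivative w * cos (w * t)) (at t)" for t
      by (auto intro!: derivative_eq_intros)
    moreover have "((\<lambda>t. w * cos (w * t)) has_real_derivative - w\<^sup>2 * sin (w * t)) (at t)" for t
      by (auto intro!: derivative_eq_intros simp: power2_eq_square)
    ultimately have "jacobi_operator g X (\<lambda>q. sin (w * q$2)) q =
        (1 + \<tau>\<^sup>2 * r\<^sup>2) * (- w\<^sup>2 * sin (w * q$2)) + c\<^sup>2 * sin (w * q$2)"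
      by (rule jacobi_height)
    then show ?thesis by (simp add: \<mu>_def algebra_simps)
  qed
  then have "index_form g X ?D (u \<circ> X) = - (\<mu> * integral ?D (\<lambda>q. (sin (w * q$2))\<^sup>2))"
    by (simp add: index_form_def surface_integral_def uX volume_density_first_form
        power2_eq_square mult.left_commute flip: integral_mult_right)
  with nonneg \<open>\<mu> > 0\<close> have le: "integral ?D (\<lambda>q. (sin (w * q$2))\<^sup>2) \<le> 0"
    by (simp add: mult_le_0_iff)
  have cont: "continuous_on (cbox 0 (vector [\<l>, L])) (\<lambda>q::real^2. (sin (w * q$2))\<^sup>2)"
    by (intro continuous_intros)
  have int: "((\<lambda>q::real^2. (sin (w * q$2))\<^sup>2) has_integral integral ?D (\<lambda>q. (sin (w * q$2))\<^sup>2))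
      (cbox 0 (vector [\<l>, L]))"
    using integrable_continuous[OF cont] by (simp add: param_rectangle_def integrable_integral)
  have "integral ?D (\<lambda>q. (sin (w * q$2))\<^sup>2) \<ge> 0"
    using int by (rule has_integral_nonneg) simp
  with le int have int0: "((\<lambda>q::real^2. (sin (w * q$2))\<^sup>2) has_integral 0) (cbox 0 (vector [\<l>, L]))"
    by simp
  \<comment> \<open>A nonnegative continuous function with integral zero vanishes on the rectangle.
    The contradiction comes at a quarter period, where the sine is 1; the point is interior, which
    also shows that the box is nondegenerate.\<close>
  have "vector [\<l> / 2, L / 4] \<in> box 0 (vector [\<l>, L] :: real^2)"
    using \<open>\<l> > 0\<close> \<open>L > 0\<close> by (simp add: mem_box_cart forall_2)
  then have "(sin (w * (vector [\<l> / 2, L / 4] :: real^2)$2))\<^sup>2 = 0"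
    using has_integral_0_cbox_imp_0[OF cont _ int0] box_subset_cbox by fastforce
  moreover have quarter: "w * (L / 4) = pi / 2" using \<open>L > 0\<close> by (simp add: w_def)
  ultimately show False unfolding vector_2 quarter by simp
qed

end

section \<open>Distance from the origin in \<open>\<bbbM>\<^sup>2(\<kappa>)\<close>\<close>

text \<open>The primitive of the conformal factor along a Euclidean ray.\<close>

definition M2_radius :: "real \<Rightarrow> real \<Rightarrow> real" where
  "M2_radius \<kappa> R =
     (if \<kappa> < 0 then 2 / sqrt (- \<kappa>) * artanh (sqrt (- \<kappa>) * R / 2)
      else if \<kappa> = 0 then R
      else 2 / sqrt \<kappa> * arctan (sqrt \<kappa> * R / 2))"

lemma M2_radius_0 [simp]: "M2_radius \<kappa> 0 = 0"
  by (simp add: M2_radius_def)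

lemma half_sqrt_less_1:
  assumes "\<kappa> < 0" "4 + \<kappa> * R\<^sup>2 > 0"
  shows "\<bar>sqrt (- \<kappa>) * R / 2\<bar> < 1"
proof -
  have "(sqrt (- \<kappa>) * R / 2)\<^sup>2 < 1\<^sup>2"
    using assms by (simp add: power_mult_distrib power_divide)
  then show ?thesis by (simp only: one_power2 abs_square_less_1)
qed

lemma M2_radius_deriv:
  assumes pos: "4 + \<kappa> * R\<^sup>2 > 0"
  shows "(M2_radius \<kappa> has_real_derivative 4 / (4 + \<kappa> * R\<^sup>2)) (at R)"
proof -
  consider "\<kappa> < 0" | "\<kappa> = 0" | "\<kappa> > 0" by linarith
  then show ?thesis
  proof cases
    case 1
    define a where "a = sqrt (- \<kappa>)"
    have a: "a > 0" "\<kappa> = - a\<^sup>2" using 1 by (simp_all add: a_def)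
    have "\<bar>a * R / 2\<bar> < 1" using half_sqrt_less_1[OF 1 pos] by (simp add: a_def)
    then have "((\<lambda>R. 2 / a * artanh (a * R / 2)) has_real_derivative
        2 / a * (1 / (1 - (a * R / 2)\<^sup>2) * (a / 2))) (at R)"
      by (auto intro!: derivative_eq_intros DERIV_chain'[where g = artanh])
    moreover have "2 / a * (1 / (1 - (a * R / 2)\<^sup>2) * (a / 2)) = 4 / (4 + \<kappa> * R\<^sup>2)"
      using a pos by (simp add: field_simps power2_eq_square)
    ultimately show ?thesis using 1 by (simp add: M2_radius_def[abs_def] a_def)
  next
    case 2
    then show ?thesis by (simp add: M2_radius_def[abs_def])
  next
    case 3
    define a where "a = sqrt \<kappa>"
    have a: "a > 0" "\<kappa> = a\<^sup>2" using 3 by (simp_all add: a_def)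
    have "((\<lambda>R. 2 / a * arctan (a * R / 2)) has_real_derivative
        2 / a * (inverse (1 + (a * R / 2)\<^sup>2) * (a / 2))) (at R)"
      by (auto intro!: derivative_eq_intros DERIV_chain'[where g = arctan])
    moreover have "1 + (a * R / 2)\<^sup>2 > 0" by (simp add: add_pos_nonneg)
    then have "2 / a * (inverse (1 + (a * R / 2)\<^sup>2) * (a / 2)) = 4 / (4 + \<kappa> * R\<^sup>2)"
      using a pos by (simp add: field_simps power2_eq_square)
    ultimately show ?thesis using 3 by (simp add: M2_radius_def[abs_def] a_def)
  qed
qed

lemma radial_domain_mono:
  fixes \<kappa> R :: real
  assumes "0 \<le> R'" "R' \<le> R" "4 + \<kappa> * R\<^sup>2 > 0"
  shows "4 + \<kappa> * R'\<^sup>2 > 0"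
proof (cases "\<kappa> \<ge> 0")
  case True
  then show ?thesis by (simp add: add_pos_nonneg)
next
  case False
  have "R'\<^sup>2 \<le> R\<^sup>2" using assms by (simp add: power_mono)
  then have "\<kappa> * R\<^sup>2 \<le> \<kappa> * R'\<^sup>2" using False by (intro mult_left_mono_neg) auto
  then show ?thesis using assms by linarith
qed

text \<open>The derivative is the conformal factor, which is positive on the whole interval.
  Distance from the origin thus determines the Euclidean radius.\<close>

lemma M2_radius_less:
  assumes "0 \<le> R'" "R' < R" "4 + \<kappa> * R\<^sup>2 > 0"
  shows "M2_radius \<kappa> R' < M2_radius \<kappa> R"
proof (rule DERIV_pos_imp_increasing[OF assms(2)])
  fix x assume "R' \<le> x" "x \<le> R"
  then have "4 + \<kappa> * x\<^sup>2 > 0" using radial_domain_mono assms by (meson order_trans)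
  then show "\<exists>y. (M2_radius \<kappa> has_real_derivative y) (at x) \<and> 0 < y"
    using M2_radius_deriv[of \<kappa> x] by (intro exI[of _ "4 / (4 + \<kappa> * x\<^sup>2)"]) simp
qed

section \<open>Lengths of curves from the origin\<close>

lemma norm_sq_real2: "(norm (p :: real^2))\<^sup>2 = (p$1)\<^sup>2 + (p$2)\<^sup>2"
  unfolding power2_norm_eq_inner inner_vec_def sum_2 by (simp add: power2_eq_square)

lemma conf_factor_norm: "conf_factor \<kappa> p = 4 / (4 + \<kappa> * (norm p)\<^sup>2)"
  by (simp add: conf_factor_def norm_sq_real2)

lemma M2_domain_norm: "p \<in> M2_domain \<kappa> \<Longrightarrow> 4 + \<kappa> * (norm p)\<^sup>2 > 0"
  using M2_domain_pos by (simp add: norm_sq_real2)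

lemma M2_speed:
  assumes "p \<in> M2_domain \<kappa>"
  shows "sqrt (M2_metric \<kappa> p v v) = conf_factor \<kappa> p * norm v"
proof -
  have "M2_metric \<kappa> p v v = (conf_factor \<kappa> p * norm v)\<^sup>2"
    unfolding M2_metric_def power_mult_distrib norm_sq_real2 by (simp add: power2_eq_square)
  moreover have "conf_factor \<kappa> p > 0" using M2_domain_norm[OF assms] by (simp add: conf_factor_norm)
  ultimately show ?thesis by simp
qed

lemma norm_curve_deriv:
  fixes \<gamma> :: "real \<Rightarrow> 'a::real_inner"
  assumes "(\<gamma> has_vector_derivative v) (at t)" "\<gamma> t \<noteq> 0"
  shows "((\<lambda>t. norm (\<gamma> t)) has_real_derivative (\<gamma> t \<bullet> v) / norm (\<gamma> t)) (at t)"
proof -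
  have "((\<lambda>t. \<gamma> t \<bullet> \<gamma> t) has_derivative (\<lambda>h. 2 * (\<gamma> t \<bullet> v) * h)) (at t)"
    using assms(1) unfolding has_vector_derivative_def
    by (auto intro!: derivative_eq_intros simp: inner_commute)
  then have "((\<lambda>t. \<gamma> t \<bullet> \<gamma> t) has_real_derivative 2 * (\<gamma> t \<bullet> v)) (at t)"
    by (simp add: has_field_derivative_def mult_commute_abs)
  from DERIV_chain2[OF DERIV_real_sqrt this] assms(2)
  show ?thesis by (simp add: norm_eq_sqrt_inner field_simps)
qed

text \<open>The derivative of \<open>M2_radius \<kappa> (norm (\<gamma> t))\<close> is the conformal
  factor times the radial part of the velocity. By Cauchy-Schwarz it is at most the speed, and
  integration gives the bound.\<close>

lemma curve_length_ge:
  assumes C1: "\<gamma> C1_differentiable_on {0..1}" and dom: "\<gamma> ` {0..1} \<subseteq> M2_domain \<kappa>"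
    and ends: "\<gamma> 0 = 0" "\<gamma> 1 = p"
  shows "M2_radius \<kappa> (norm p) \<le> curve_length (M2_metric \<kappa>) \<gamma>"
proof -
  let ?v = "\<lambda>t. vector_derivative \<gamma> (at t)"
  have d: "(\<gamma> has_vector_derivative ?v t) (at t)" if "t \<in> {0..1}" for t
    using C1 that C1_differentiable_on_eq vector_derivative_works by blast
  have contv: "continuous_on {0..1} ?v" using C1 C1_differentiable_on_eq by blast
  have cont: "continuous_on {0..1} \<gamma>"
    using d by (meson continuous_at_imp_continuous_on has_vector_derivative_continuous)
  have pos: "4 + \<kappa> * (norm (\<gamma> t))\<^sup>2 > 0" if "t \<in> {0..1}" for t
    using dom that M2_domain_norm by blast
  define I where "I = (\<lambda>t. conf_factor \<kappa> (\<gamma> t) * norm (?v t))"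
  have contI: "continuous_on {0..1} I"
    unfolding I_def conf_factor_norm
    by (intro continuous_intros cont contv) (use pos in force)
  have I0: "I t \<ge> 0" if "t \<in> {0..1}" for t
    using pos[OF that] by (simp add: I_def conf_factor_norm)
  have len: "curve_length (M2_metric \<kappa>) \<gamma> = integral {0..1} I"
    unfolding curve_length_def I_def
    by (rule integral_cong) (use dom in \<open>auto intro!: M2_speed\<close>)
  \<comment> \<open>The Euclidean norm is not differentiable at the origin, so only the part of the curve after its
    last visit there is used.\<close>
  define Z where "Z = {t \<in> {0..1}. \<gamma> t = 0}"
  have "closed Z" unfolding Z_def
    by (rule continuous_closed_preimage_constant[OF cont]) simp
  moreover have "Z \<subseteq> {0..1}" "0 \<in> Z" using ends(1) by (auto simp: Z_def)
  moreover have bdd: "bdd_above Z" using \<open>Z \<subseteq> {0..1}\<close> by (rule bdd_above_mono[rotated]) simp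
  ultimately have "Sup Z \<in> Z" by (intro closed_contains_Sup) auto
  define t0 where "t0 = Sup Z"
  have t0: "0 \<le> t0" "t0 \<le> 1" "\<gamma> t0 = 0" using \<open>Sup Z \<in> Z\<close> by (auto simp: Z_def t0_def)
  have nz: "\<gamma> t \<noteq> 0" if "t0 < t" "t \<le> 1" for t
  proof
    assume "\<gamma> t = 0"
    then have "t \<in> Z" using that t0 by (simp add: Z_def)
    then have "t \<le> t0" unfolding t0_def using bdd by (rule cSup_upper)
    with that show False by simp
  qed
  define f where "f = (\<lambda>t. M2_radius \<kappa> (norm (\<gamma> t)))"
  define f' where "f' = (\<lambda>t. 4 / (4 + \<kappa> * (norm (\<gamma> t))\<^sup>2) * ((\<gamma> t \<bullet> ?v t) / norm (\<gamma> t)))"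
  have "(f' has_integral (f 1 - f t0)) {t0..1}"
  \<comment> \<open>The version for open intervals: at \<open>t0\<close> the norm need only be
    continuous.\<close>
  proof (rule fundamental_theorem_of_calculus_interior[OF t0(2)])
    have "continuous_on {t0..1} (\<lambda>t. norm (\<gamma> t))"
      using cont t0 by (intro continuous_intros) (auto intro: continuous_on_subset)
    moreover have "continuous_on ((\<lambda>t. norm (\<gamma> t)) ` {t0..1}) (M2_radius \<kappa>)"
      using pos t0 by (intro DERIV_continuous_on) (auto intro!: has_field_derivative_at_within[OF M2_radius_deriv])
    ultimately show "continuous_on {t0..1} f"
      unfolding f_def by (intro continuous_on_compose2[of _ "M2_radius \<kappa>" _ "\<lambda>t. norm (\<gamma> t)"]) auto
    fix t assume t: "t \<in> {t0<..<1}"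
    then have "t \<in> {0..1}" "\<gamma> t \<noteq> 0" using t0 nz by auto
    from DERIV_chain2[OF M2_radius_deriv[OF pos[OF this(1)]] norm_curve_deriv[OF d[OF this(1)] this(2)]]
    show "(f has_vector_derivative f' t) (at t)"
      by (simp add: f_def f'_def has_real_derivative_iff_has_vector_derivative)
  qed
  moreover have intI: "I integrable_on {t0..1}" "I integrable_on {0..1}"
    using contI t0 by (auto intro!: integrable_continuous_real intro: continuous_on_subset)
  then have "(I has_integral integral {t0..1} I) {t0..1}" by blast
  moreover have "f' t \<le> I t" if "t \<in> {t0..1}" for t
  proof -
    have t: "t \<in> {0..1}" using that t0 by auto
    have "\<gamma> t \<bullet> ?v t \<le> norm (\<gamma> t) * norm (?v t)" by (rule norm_cauchy_schwarz)
    then have "(\<gamma> t \<bullet> ?v t) / norm (\<gamma> t) \<le> norm (?v t)"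
      \<comment> \<open>At the origin the quotient is 0 by the convention for division, so the
        estimate persists at \<open>t0\<close>.\<close>
      by (cases "\<gamma> t = 0") (simp_all add: field_simps)
    then show ?thesis
      using pos[OF t] unfolding f'_def I_def conf_factor_norm by (intro mult_left_mono) auto
  qed
  ultimately have "f 1 - f t0 \<le> integral {t0..1} I" by (rule has_integral_le)
  also have "\<dots> \<le> integral {0..1} I"
    using intI I0 t0 by (intro integral_subset_le) auto
  finally show ?thesis by (simp add: len f_def t0 ends)
qed

text \<open>The straight segment attains the bound of \<open>curve_length_ge\<close>, since
  \<open>M2_radius\<close> is the primitive of its speed.\<close>

lemma radial_segment:
  assumes p: "p \<in> M2_domain \<kappa>"
  defines "\<gamma> \<equiv> \<lambda>t. t *\<^sub>R p"
  shows "\<gamma> C1_differentiable_on {0..1}" "\<gamma> ` {0..1} \<subseteq> M2_domain \<kappa>"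
    "curve_length (M2_metric \<kappa>) \<gamma> = M2_radius \<kappa> (norm p)"
proof -
  have d: "(\<gamma> has_vector_derivative p) (at t)" for t
    unfolding \<gamma>_def by (auto intro!: derivative_eq_intros)
  then show "\<gamma> C1_differentiable_on {0..1}"
    unfolding C1_differentiable_on_def by (intro exI[of _ "\<lambda>_. p"]) auto
  show dom: "\<gamma> ` {0..1} \<subseteq> M2_domain \<kappa>"
  proof clarify
    fix t :: real assume t: "t \<in> {0..1}"
    have "(norm (\<gamma> t))\<^sup>2 \<le> (norm p)\<^sup>2"
      using t by (intro power_mono) (simp_all add: \<gamma>_def mult_left_le_one_le)
    then show "\<gamma> t \<in> M2_domain \<kappa>" using p by (auto simp: M2_domain_def norm_sq_real2)
  qed
  have "((\<lambda>t. conf_factor \<kappa> (\<gamma> t) * norm p) has_integral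
      M2_radius \<kappa> (1 * norm p) - M2_radius \<kappa> (0 * norm p)) {0..1}"
  proof (rule fundamental_theorem_of_calculus)
    fix t :: real assume t: "t \<in> {0..1}"
    then have n: "norm (\<gamma> t) = t * norm p" by (simp add: \<gamma>_def)
    have "4 + \<kappa> * (t * norm p)\<^sup>2 > 0" using dom t M2_domain_norm n by (metis image_subset_iff)
    from M2_radius_deriv[OF this]
    have "((\<lambda>t. M2_radius \<kappa> (t * norm p)) has_real_derivative
        4 / (4 + \<kappa> * (t * norm p)\<^sup>2) * norm p) (at t)"
      by (rule DERIV_chain2) (auto intro!: derivative_eq_intros)
    then show "((\<lambda>t. M2_radius \<kappa> (t * norm p)) has_vector_derivative
        conf_factor \<kappa> (\<gamma> t) * norm p) (at t within {0..1})"
      by (simp add: conf_factor_norm n has_field_derivative_at_within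
          flip: has_real_derivative_iff_has_vector_derivative)
  qed simp
  from integral_unique[OF this]
  have "integral {0..1} (\<lambda>t. conf_factor \<kappa> (\<gamma> t) * norm p) = M2_radius \<kappa> (norm p)"
    by simp
  moreover have "vector_derivative \<gamma> (at t) = p" for t using d by (rule vector_derivative_at)
  then have "curve_length (M2_metric \<kappa>) \<gamma> = integral {0..1} (\<lambda>t. conf_factor \<kappa> (\<gamma> t) * norm p)"
    unfolding curve_length_def
    by (intro integral_cong) (use dom in \<open>auto intro!: M2_speed\<close>)
  ultimately show "curve_length (M2_metric \<kappa>) \<gamma> = M2_radius \<kappa> (norm p)" by simp
qed

lemma geodesic_dist_origin:
  assumes p: "p \<in> M2_domain \<kappa>"
  shows "geodesic_dist (M2_metric \<kappa>) (M2_domain \<kappa>) 0 p = M2_radius \<kappa> (norm p)"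
  unfolding geodesic_dist_def
proof (rule cInf_eq_minimum)
  show "M2_radius \<kappa> (norm p) \<in> {curve_length (M2_metric \<kappa>) \<gamma> |\<gamma>. \<gamma> C1_differentiable_on {0..1} \<and>
      \<gamma> ` {0..1} \<subseteq> M2_domain \<kappa> \<and> \<gamma> 0 = 0 \<and> \<gamma> 1 = p}"
    using radial_segment[OF p] by (intro CollectI exI[of _ "\<lambda>t. t *\<^sub>R p"]) simp
qed (use curve_length_ge in auto)

section \<open>The critical height\<close>

lemma tanh_artanh_real:
  fixes v :: real
  assumes "\<bar>v\<bar> < 1"
  shows "tanh (artanh v) = v"
proof -
  have v: "1 + v > 0" "1 - v > 0" using assms by auto
  then have e: "exp (- 2 * artanh v) = (1 - v) / (1 + v)"
    by (simp add: artanh_def exp_minus)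
  show ?thesis unfolding tanh_real_altdef e using v by (simp add: field_simps)
qed

text \<open>With \<open>a\<close> the square root of the absolute curvature,
  \<open>v = a * R / 2\<close> is the tanh or tan of half the scaled radius. The double angle
  formulas turn the sinh or sin into a rational function of \<open>v\<close>, and \<open>a\<close>
  factors out of the root. The result is the length of the circle times
  \<open>sqrt (1 + \<tau>\<^sup>2 * R\<^sup>2)\<close>.\<close>

lemma critical_height_radius:
  assumes R: "R > 0" and pos: "4 + \<kappa> * R\<^sup>2 > 0"
  shows "critical_height \<kappa> \<tau> (M2_radius \<kappa> R) =
    2 * pi * (4 / (4 + \<kappa> * R\<^sup>2)) * R * sqrt (1 + \<tau>\<^sup>2 * R\<^sup>2)"
proof -
  consider "\<kappa> < 0" | "\<kappa> = 0" | "\<kappa> > 0" by linarith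
  then show ?thesis
  proof cases
    case 1
    define a v where "a = sqrt (- \<kappa>)" and "v = a * R / 2"
    have a: "a > 0" "\<kappa> = - a\<^sup>2" using 1 by (simp_all add: a_def)
    have v: "v > 0" "\<bar>v\<bar> < 1"
      using half_sqrt_less_1[OF 1 pos] a(1) R unfolding a_def[symmetric] v_def by simp_all
    then have v1: "1 - v\<^sup>2 > 0" by (simp add: abs_square_less_1)
    have \<rho>: "M2_radius \<kappa> R * a = 2 * artanh v"
      using 1 a(1) unfolding M2_radius_def a_def[symmetric] v_def by simp
    have th: "tanh (artanh v) = v"
      using v by (intro tanh_artanh_real) simp
    have "sinh (artanh v) = v * cosh (artanh v)"
      using th by (simp add: tanh_def field_simps)
    then have "sinh (2 * artanh v) = 2 * v * (cosh (artanh v))\<^sup>2"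
      and "(cosh (artanh v))\<^sup>2 = v\<^sup>2 * (cosh (artanh v))\<^sup>2 + 1"
      using cosh_square_eq[of "artanh v"]
      by (simp_all add: sinh_double power2_eq_square power_mult_distrib)
    moreover from this have "(cosh (artanh v))\<^sup>2 = 1 / (1 - v\<^sup>2)"
      using v1 by (simp add: field_simps)
    ultimately have "sinh (2 * artanh v) = 2 * v / (1 - v\<^sup>2)" by simp
    moreover have "sqrt (a\<^sup>2 + 4 * \<tau>\<^sup>2 * v\<^sup>2) = a * sqrt (1 + \<tau>\<^sup>2 * R\<^sup>2)"
    proof -
      have "a\<^sup>2 + 4 * \<tau>\<^sup>2 * v\<^sup>2 = a\<^sup>2 * (1 + \<tau>\<^sup>2 * R\<^sup>2)"
        by (simp add: v_def power_mult_distrib power_divide algebra_simps)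
      then show ?thesis using a by (simp add: real_sqrt_mult)
    qed
    ultimately have "critical_height \<kappa> \<tau> (M2_radius \<kappa> R) =
        2 * pi / a\<^sup>2 * (2 * v / (1 - v\<^sup>2)) * (a * sqrt (1 + \<tau>\<^sup>2 * R\<^sup>2))"
      using 1 a(2) unfolding critical_height_def a_def[symmetric] \<rho> by (simp add: th)
    also have "\<dots> = 2 * pi * (4 / (4 + \<kappa> * R\<^sup>2)) * R * sqrt (1 + \<tau>\<^sup>2 * R\<^sup>2)"
      using a v1 pos by (simp add: v_def field_simps power2_eq_square)
    finally show ?thesis .
  next
    case 2
    then show ?thesis by (simp add: critical_height_def M2_radius_def)
  next
    case 3
    define a v where "a = sqrt \<kappa>" and "v = a * R / 2"
    have a: "a > 0" "\<kappa> = a\<^sup>2" using 3 by (simp_all add: a_def)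
    have v: "v > 0" using a R by (simp add: v_def)
    have v1: "1 + v\<^sup>2 > 0" by (simp add: add_pos_nonneg)
    have \<rho>: "M2_radius \<kappa> R * a = 2 * arctan v"
      using 3 a(1) unfolding M2_radius_def a_def[symmetric] v_def by simp
    have "sin (2 * arctan v) = 2 * v / (1 + v\<^sup>2)"
      using v1 by (simp add: sin_double sin_arctan cos_arctan)
    moreover have "sqrt (a\<^sup>2 + 4 * \<tau>\<^sup>2 * v\<^sup>2) = a * sqrt (1 + \<tau>\<^sup>2 * R\<^sup>2)"
    proof -
      have "a\<^sup>2 + 4 * \<tau>\<^sup>2 * v\<^sup>2 = a\<^sup>2 * (1 + \<tau>\<^sup>2 * R\<^sup>2)"
        by (simp add: v_def power_mult_distrib power_divide algebra_simps)
      then show ?thesis using a by (simp add: real_sqrt_mult)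
    qed
    ultimately have "critical_height \<kappa> \<tau> (M2_radius \<kappa> R) =
        2 * pi / a\<^sup>2 * (2 * v / (1 + v\<^sup>2)) * (a * sqrt (1 + \<tau>\<^sup>2 * R\<^sup>2))"
      using 3 a(2) unfolding critical_height_def a_def[symmetric] \<rho> by (simp add: tan_arctan)
    also have "\<dots> = 2 * pi * (4 / (4 * (1 + v\<^sup>2))) * R * sqrt (1 + \<tau>\<^sup>2 * R\<^sup>2)"
    proof -
      \<comment> \<open>A generic \<open>w\<close> stands for \<open>1 + v\<^sup>2\<close>, so that
        unfolding \<open>v\<close> does not touch the denominator.\<close>
      have "2 * pi / a\<^sup>2 * (2 * v / w) * (a * b) = 2 * pi * (4 / (4 * w)) * R * b"
        if "w > 0" for w b
        using a(1) that by (simp add: v_def field_simps power2_eq_square)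
      with v1 show ?thesis by blast
    qed
    also have "4 * (1 + v\<^sup>2) = 4 + \<kappa> * R\<^sup>2"
      by (simp add: a(2) v_def power_mult_distrib power_divide)
    finally show ?thesis .
  qed
qed

text \<open>Constant distance means constant Euclidean norm, so the velocity is a multiple of the
  rotated position. Unit speed fixes the absolute value of the multiple, and continuity prevents its
  sign from changing.\<close>

lemma round_cylinder_of_circle:
  assumes circ: "is_circle \<kappa> k \<l> \<alpha>" and rad: "radius_about_origin \<kappa> \<alpha> \<rho>"
  obtains c r where "r > 0" "\<rho> = M2_radius \<kappa> r" "4 + \<kappa> * r\<^sup>2 > 0"
    "round_cylinder \<kappa> c r (4 / (4 + \<kappa> * r\<^sup>2)) \<alpha>"
proof -
  let ?v = "\<lambda>t. vector_derivative \<alpha> (at t)"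
  have dom: "\<alpha> t \<in> M2_domain \<kappa>" for t using circ by (auto simp: is_circle_def)
  have speed: "M2_metric \<kappa> (\<alpha> t) (?v t) (?v t) = 1" for t using circ by (auto simp: is_circle_def)
  have "Ck_on (Suc 0) UNIV \<alpha>" using circ by (auto simp: is_circle_def smooth_on_def)
  then have diff: "\<alpha> differentiable (at t)" and
    "continuous_on UNIV (\<lambda>t. frechet_derivative \<alpha> (at t) 1)" for t
    by (auto simp: differentiable_on_def)
  then have contv: "continuous_on UNIV ?v" by (simp add: frechet_derivative_eq_vector_derivative)
  have d: "(\<alpha> has_vector_derivative ?v t) (at t)" for t
    using diff vector_derivative_works by blast
  have cont: "continuous_on UNIV \<alpha>"
    using d by (meson continuous_at_imp_continuous_on has_vector_derivative_continuous)
  define r where "r = norm (\<alpha> 0)"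
  have \<rho>: "M2_radius \<kappa> (norm (\<alpha> t)) = \<rho>" for t
    using rad geodesic_dist_origin[OF dom] by (simp add: radius_about_origin_def)
  have pos: "4 + \<kappa> * (norm (\<alpha> t))\<^sup>2 > 0" for t using M2_domain_norm[OF dom] .
  \<comment> \<open>If the norms differed, strict monotonicity of \<open>M2_radius\<close> would
    give different distances.\<close>
  have norm: "norm (\<alpha> t) = r" for t
    using M2_radius_less[of "norm (\<alpha> t)" r \<kappa>] M2_radius_less[of r "norm (\<alpha> t)" \<kappa>] pos[of t] pos[of 0]
      \<rho>[of t] \<rho>[of 0] unfolding r_def by (metis less_irrefl linorder_neqE norm_ge_zero)
  have nsq: "(\<alpha> t $ 1)\<^sup>2 + (\<alpha> t $ 2)\<^sup>2 = r\<^sup>2" for t using norm norm_sq_real2 by metis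
  \<comment> \<open>Radius 0 would make the curve constant, against unit speed.\<close>
  have r: "r > 0"
  proof (rule ccontr)
    assume "\<not> r > 0"
    then have "\<alpha> = (\<lambda>_. 0)" using norm r_def by (metis norm_le_zero_iff not_le_imp_less)
    then have "?v 0 = 0" by simp
    then show False using speed[of 0] by (simp add: M2_metric_def)
  qed
  define s where "s = 4 / (4 + \<kappa> * r\<^sup>2)"
  have conf: "conf_factor \<kappa> (\<alpha> t) = s" for t by (simp add: conf_factor_norm norm s_def)
  have s: "s > 0" using pos[of 0] by (simp add: s_def norm)
  have v_sq: "s\<^sup>2 * ((?v t $ 1)\<^sup>2 + (?v t $ 2)\<^sup>2) = 1" for t
    using speed[of t] by (simp add: M2_metric_def conf power2_eq_square)
  have orth: "\<alpha> t $ 1 * ?v t $ 1 + \<alpha> t $ 2 * ?v t $ 2 = 0" for t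
  proof -
    have "\<alpha> t \<noteq> 0" using norm r by force
    from norm_curve_deriv[OF d this] have "(\<alpha> t \<bullet> ?v t) / norm (\<alpha> t) = 0"
      unfolding norm by (metis DERIV_const DERIV_unique)
    then show ?thesis using norm r by (simp add: inner_vec_def sum_2)
  qed
  \<comment> \<open>The angular velocity: planar cross product of position and velocity over the
    squared radius.\<close>
  define C where "C = (\<lambda>t. (\<alpha> t $ 1 * ?v t $ 2 - \<alpha> t $ 2 * ?v t $ 1) / r\<^sup>2)"
  have v: "?v t = C t *\<^sub>R rot90 (\<alpha> t)" for t
  proof -
    have "?v t $ 1 * r\<^sup>2 = - (\<alpha> t $ 1 * ?v t $ 2 - \<alpha> t $ 2 * ?v t $ 1) * \<alpha> t $ 2"
      "?v t $ 2 * r\<^sup>2 = (\<alpha> t $ 1 * ?v t $ 2 - \<alpha> t $ 2 * ?v t $ 1) * \<alpha> t $ 1"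
      unfolding nsq[of t, symmetric] using orth[of t] by algebra+
    then show ?thesis using r by (simp add: vec_eq_iff forall_2 rot90_def C_def field_simps)
  qed
  have C_sq: "(C t)\<^sup>2 * s\<^sup>2 * r\<^sup>2 = 1" for t
  proof -
    have "(?v t $ 1)\<^sup>2 + (?v t $ 2)\<^sup>2 = (C t)\<^sup>2 * ((\<alpha> t $ 1)\<^sup>2 + (\<alpha> t $ 2)\<^sup>2)"
      unfolding v by (simp add: rot90_def power_mult_distrib algebra_simps)
    then show ?thesis using v_sq[of t] nsq[of t] by (simp add: mult_ac)
  qed
  have contC: "continuous_on UNIV C"
    unfolding C_def using r by (intro continuous_intros cont contv) auto
  have "C t \<in> {1 / (s * r), - (1 / (s * r))}" for t
  proof -
    have "(C t)\<^sup>2 = (1 / (s * r))\<^sup>2"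
      using C_sq[of t] s r by (simp add: field_simps)
    then show ?thesis by (simp add: power2_eq_iff)
  qed
  \<comment> \<open>A continuous function on the connected real line with finitely many values is
    constant.\<close>
  then have "finite (C ` UNIV)" by (meson finite.emptyI finite.insertI finite_subset image_subsetI)
  then obtain c where c: "C t = c" for t
    using continuous_finite_range_constant[OF connected_UNIV contC]
    by (metis constant_on_def UNIV_I)
  have "round_cylinder \<kappa> c r s \<alpha>"
    using d dom nsq C_sq v c by unfold_locales (simp_all add: s_def)
  with that[of r c] r \<rho>[of 0] pos[of 0] show thesis by (simp add: s_def norm)
qed

theorem theorem1p2:
  fixes \<kappa> \<tau> \<rho> L k \<l> :: real and \<alpha> :: "real \<Rightarrow> real^2"
  assumes "is_circle \<kappa> k \<l> \<alpha>"
    and "radius_about_origin \<kappa> \<alpha> \<rho>"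
    and "L > critical_height \<kappa> \<tau> \<rho>"
    and "\<kappa> > 0 \<Longrightarrow> \<tau> \<noteq> 0 \<Longrightarrow> L < 8 * \<tau> * pi / \<kappa>"
  shows "\<not> stable_surface (E_metric \<kappa> \<tau>) (cylinder_param \<alpha>) (param_rectangle \<l> L)
           (truncated_cylinder_boundary \<kappa> \<alpha> L)"
proof -
  obtain c r where r: "r > 0" "\<rho> = M2_radius \<kappa> r" and pos: "4 + \<kappa> * r\<^sup>2 > 0"
    and cyl: "round_cylinder \<kappa> c r (4 / (4 + \<kappa> * r\<^sup>2)) \<alpha>"
    using round_cylinder_of_circle[OF assms(1,2)] .
  define s where "s = 4 / (4 + \<kappa> * r\<^sup>2)"
  have s: "s > 0" using pos by (simp add: s_def)
  interpret round_cylinder \<kappa> \<tau> c r s \<alpha> using cyl unfolding s_def .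
  have h: "2 * pi * s * r * sqrt (1 + \<tau>\<^sup>2 * r\<^sup>2) < L"
    using assms(3) critical_height_radius[OF r(1) pos] by (simp add: r(2) s_def)
  have h0: "0 < 2 * pi * s * r * sqrt (1 + \<tau>\<^sup>2 * r\<^sup>2)"
    using s r by (simp add: add_pos_nonneg)
  from h h0 have "(2 * pi * s * r * sqrt (1 + \<tau>\<^sup>2 * r\<^sup>2))\<^sup>2 < L\<^sup>2"
    by (intro power_strict_mono) auto
  moreover have "(2 * a * s * r * b)\<^sup>2 = 4 * a\<^sup>2 * b\<^sup>2 * (s\<^sup>2 * r\<^sup>2)" for a b
    by (simp add: power2_eq_square)
  moreover have "(sqrt (1 + \<tau>\<^sup>2 * r\<^sup>2))\<^sup>2 = 1 + \<tau>\<^sup>2 * r\<^sup>2" by simp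
  \<comment> \<open>The factor 1 on the right is written as
    \<open>c\<^sup>2 * s\<^sup>2 * r\<^sup>2\<close>; cancelling
    \<open>s\<^sup>2 * r\<^sup>2\<close> then yields the hypothesis of
    \<open>unstable\<close>.\<close>
  ultimately have "4 * pi\<^sup>2 * (1 + \<tau>\<^sup>2 * r\<^sup>2) * (s\<^sup>2 * r\<^sup>2) < L\<^sup>2 * (c\<^sup>2 * s\<^sup>2 * r\<^sup>2)"
    by (simp only: unit_speed mult_1_right)
  then have "4 * pi\<^sup>2 * (1 + \<tau>\<^sup>2 * r\<^sup>2) * (s\<^sup>2 * r\<^sup>2) < (c\<^sup>2 * L\<^sup>2) * (s\<^sup>2 * r\<^sup>2)"
    by (simp only: mult_ac)
  then have "4 * pi\<^sup>2 * (1 + \<tau>\<^sup>2 * r\<^sup>2) < c\<^sup>2 * L\<^sup>2"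
    by (rule mult_right_less_imp_less) simp
  moreover have "\<l> > 0" using assms(1) by (simp add: is_circle_def)
  moreover have "L > 0" using h h0 by linarith
  ultimately show ?thesis by (intro unstable)
qed

end
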